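(* Let $\Omega\subset\mathbb{C}^r_t\times\mathbb{C}^n_z$ be a pseudoconvex domain, and let $p:\Omega\to U:=p(\Omega)\subset\mathbb{C}^r$, $p(t,z)=t$, be the natural projection. Let $\varphi$ be a plurisubharmonic function on $\Omega$. Assume that for every $t\in U$ the fiber $\Omega_t:=p^{-1}(t)$ is a connected tube domain, and that $\varphi(t,z)$ is independent of the imaginary part of $z$ for all $(t,z)\in\Omega$. Then the function $\varphi^*$ defined by $$\varphi^*(t):=\inf_{z\in\Omega_t}\varphi(t,z)$$ is a plurisubharmonic function on $U$.
   Context: Coordinates on $\mathbb{C}^r\times\mathbb{C}^n$ are denoted $(t,z)$. The fiber $\Omega_t=p^{-1}(t)$ is identified with the open set $\{z\in\mathbb{C}^n : (t,z)\in\Omega\}$. A connected tube domain in $\mathbb{C}^n$ is a set of the form $\omega+i\mathbb{R}^n$ with $\omega\subset\mathbb{R}^n$ a nonempty connected open set. That $\varphi(t,z)$ is independent of the imaginary part of $z$ means $\varphi(t,z)=\varphi(t,z+iy)$ for all $(t,z)\in\Omega$ and $y\in\mathbb{R}^n$. Plurisubharmonic functions take values in $[-\infty,\infty)$, and the function identically $-\infty$ is regarded as plurisubharmonic. *)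

theory Defs
  imports "HOL-Analysis.Analysis"
begin

(* Complex vector spaces as a type class: the library has them only for single types
   (complex, and complex ^ 'n via *s), but a common complex scaling is needed on C^r x C^n
   as well. *)

class complex_vector = real_vector +
  fixes scaleC :: "complex \<Rightarrow> 'a \<Rightarrow> 'a"  (infixr \<open>*\<^sub>C\<close> 75)
  assumes scaleC_add_right: "c *\<^sub>C (x + y) = c *\<^sub>C x + c *\<^sub>C y"
    and scaleC_add_left: "(c + d) *\<^sub>C x = c *\<^sub>C x + d *\<^sub>C x"
    and scaleC_scaleC: "c *\<^sub>C d *\<^sub>C x = (c * d) *\<^sub>C x"
    and scaleC_one: "1 *\<^sub>C x = x"
    and scaleR_scaleC: "r *\<^sub>R x = complex_of_real r *\<^sub>C x"

instantiation complex :: complex_vector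
begin

definition scaleC_complex :: "complex \<Rightarrow> complex \<Rightarrow> complex" where
  "scaleC_complex c x = c * x"

instance
  by standard (simp_all add: scaleC_complex_def algebra_simps scaleR_conv_of_real)

end

instantiation vec :: (complex_vector, finite) complex_vector
begin

definition scaleC_vec :: "complex \<Rightarrow> 'a ^ 'b \<Rightarrow> 'a ^ 'b" where
  "scaleC_vec c x = (\<chi> i. c *\<^sub>C (x $ i))"

instance
  by standard (simp_all add: scaleC_vec_def vec_eq_iff scaleC_add_right scaleC_add_left
      scaleC_scaleC scaleC_one scaleR_scaleC)

end

instantiation prod :: (complex_vector, complex_vector) complex_vector
begin

definition scaleC_prod :: "complex \<Rightarrow> 'a \<times> 'b \<Rightarrow> 'a \<times> 'b" where
  "scaleC_prod c x = (c *\<^sub>C fst x, c *\<^sub>C snd x)"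

instance
  by standard (simp_all add: scaleC_prod_def prod_eq_iff scaleC_add_right scaleC_add_left
      scaleC_scaleC scaleC_one scaleR_scaleC)

end

definition usc_on :: "('a::topological_space \<Rightarrow> ereal) \<Rightarrow> 'a set \<Rightarrow> bool" where
  "usc_on u S \<longleftrightarrow> (\<forall>x\<in>S. \<forall>c. u x < c \<longrightarrow> (\<forall>\<^sub>F y in at x within S. u y < c))"

(* The mean of u over the circle of centre a and radius r, as the integral of the positive part
   minus that of the negative part (e2ennreal sends negative numbers to 0). For u upper
   semicontinuous and < \<infinity> on the circle, u is bounded above there, so the first integral is
   finite and the difference is a well-defined element of [-\<infinity>, \<infinity>). *)
definition circle_mean :: "(complex \<Rightarrow> ereal) \<Rightarrow> complex \<Rightarrow> real \<Rightarrow> ereal" where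
  "circle_mean u a r =
     (enn2ereal (\<integral>\<^sup>+\<theta>\<in>{0..2 * pi}. e2ennreal (u (a + of_real r * cis \<theta>)) \<partial>lborel)
    - enn2ereal (\<integral>\<^sup>+\<theta>\<in>{0..2 * pi}. e2ennreal (- u (a + of_real r * cis \<theta>)) \<partial>lborel))
     / ereal (2 * pi)"

(* The function identically -\<infinity> counts as (pluri)subharmonic. *)
definition subharmonic_on :: "(complex \<Rightarrow> ereal) \<Rightarrow> complex set \<Rightarrow> bool" where
  "subharmonic_on u S \<longleftrightarrow>
     open S \<and> (\<forall>z\<in>S. u z < \<infinity>) \<and> usc_on u S \<and>
     (\<forall>a r. 0 < r \<and> cball a r \<subseteq> S \<longrightarrow> u a \<le> circle_mean u a r)"

definition plurisubharmonic_on ::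
    "('a::{complex_vector, topological_space} \<Rightarrow> ereal) \<Rightarrow> 'a set \<Rightarrow> bool" where
  "plurisubharmonic_on u S \<longleftrightarrow>
     open S \<and> (\<forall>x\<in>S. u x < \<infinity>) \<and> usc_on u S \<and>
     (\<forall>a\<in>S. \<forall>w. subharmonic_on (\<lambda>\<zeta>. u (a + \<zeta> *\<^sub>C w)) {\<zeta>. a + \<zeta> *\<^sub>C w \<in> S})"

definition pseudoconvex_domain :: "'a::{complex_vector, topological_space} set \<Rightarrow> bool" where
  "pseudoconvex_domain S \<longleftrightarrow>
     open S \<and> connected S \<and> S \<noteq> {} \<and>
     (\<exists>\<rho> :: 'a \<Rightarrow> real. continuous_on S \<rho> \<and> plurisubharmonic_on (\<lambda>x. ereal (\<rho> x)) S \<and>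
        (\<forall>c. compact {x \<in> S. \<rho> x \<le> c}))"

definition fiber :: "('a \<times> 'b) set \<Rightarrow> 'a \<Rightarrow> 'b set" where
  "fiber \<Omega> t = {z. (t, z) \<in> \<Omega>}"

definition connected_tube_domain :: "(complex ^ 'n) set \<Rightarrow> bool" where
  "connected_tube_domain T \<longleftrightarrow>
     (\<exists>\<omega> :: (real ^ 'n) set. \<omega> \<noteq> {} \<and> open \<omega> \<and> connected \<omega> \<and>
        T = {(\<chi> i. Complex (x $ i) (y $ i)) | x y. x \<in> \<omega>})"

end

theory Submission
  imports Defs "HOL-Complex_Analysis.Cauchy_Integral_Formula"
begin

text \<open>The theorem is Kiselman's minimum principle.  The proof works with analytic discs
throughout.

Upper semicontinuity of the infimum and finiteness from above are immediate, so the claim is the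
sub-mean value inequality on a disc in the parameter space.  An upper semicontinuous
function on a circle has harmonic majorants \<open>Re p\<close> with almost the same mean
(\<open>circle_mean_harmonic_majorant\<close>), so it suffices to show: if the infimum is below \<open>Re p\<close> over
the circle, then it is at most \<open>Re p\<close> at the centre (\<open>fiberwise_infimum_harmonic_bound\<close>).

For this purpose choose, over the circle, points \<open>x\<close> in the bases of the fibres with
\<open>\<phi> < Re p\<close>.  Since the bases and the sublevel sets of \<open>\<phi>\<close> in them are convex, the choice can be made
continuous and extended to a continuous section over the closed disc, and then approximated
by a polynomial section \<open>q\<close>.  The values of \<open>q\<close> on the circle are the real parts of the boundary
values of a holomorphic disc.  Two facts finish the proof.

\<^item> The disc lies in \<open>\<Omega>\<close> (\<open>analytic_discs_stay_in_domain\<close>): the harmonic extensions of \<open>q\<close> from smaller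
concentric circles deform it to a point, all boundaries stay in a compact subset of \<open>\<Omega>\<close>, and the
plurisubharmonic exhaustion function prevents the discs from leaving \<open>\<Omega>\<close> through their interior.

\<^item> On the disc, \<open>\<phi>\<close> is bounded by \<open>Re p\<close> if it is so on the boundary (\<open>psh_disc_max_principle\<close>).

Convexity of the bases (\<open>tube_fiber_convex\<close>) is obtained by the same device: a disc over a single parameter,
whose boundary has real parts near two given points of the base for most of the time, can be translated
slightly so that the real part of its centre is a prescribed point of the segment between them.  Convexity of the sublevel sets (\<open>sublevel_fiber_convex\<close>) expresses that
subharmonic functions of the real part are convex.\<close>

section \<open>Circle means and upper semicontinuous functions\<close>

lemma circle_mean_mono:
  assumes "\<And>z. dist a z = \<bar>r\<bar> \<Longrightarrow> u z \<le> v z"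
  shows "circle_mean u a r \<le> circle_mean v a r"
proof -
  have le: "u (a + of_real r * cis \<theta>) \<le> v (a + of_real r * cis \<theta>)" for \<theta>
    by (rule assms) (simp add: dist_norm norm_mult)
  show ?thesis
    unfolding circle_mean_def
    by (intro ereal_divide_right_mono ereal_minus_mono less_eq_ennreal.rep_eq[THEN iffD1] nn_integral_mono mult_right_mono
        e2ennreal_mono) (use le in \<open>auto simp: ereal_uminus_le_reorder\<close>)
qed

lemma circle_mean_continuous:
  fixes g :: "complex \<Rightarrow> real"
  assumes "((\<lambda>\<theta>. g (a + of_real r * cis \<theta>)) has_integral I) {0..2 * pi}"
    and cont: "continuous_on {0..2 * pi} (\<lambda>\<theta>. g (a + of_real r * cis \<theta>))"
  shows "circle_mean (\<lambda>z. ereal (g z)) a r = ereal (I / (2 * pi))"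
proof -
  define h where "h = (\<lambda>\<theta>. g (a + of_real r * cis \<theta>))"
  have h: "set_integrable lborel {0..2 * pi} h"
    using borel_integrable_compact[OF compact_Icc cont] by (simp add: set_integrable_def h_def indicator_scaleR_eq_if)
  have I: "set_lebesgue_integral lborel {0..2 * pi} h = I"
    using set_borel_integral_eq_integral(2)[OF h] assms(1) by (simp add: h_def integral_unique)
  let ?f = "\<lambda>\<theta>. indicator {0..2 * pi} \<theta> *\<^sub>R h \<theta>"
  have f: "integrable lborel ?f" using h by (simp add: set_integrable_def)
  have p: "(\<integral>\<^sup>+\<theta>\<in>{0..2 * pi}. ennreal (h \<theta>) \<partial>lborel) = (\<integral>\<^sup>+\<theta>. ennreal (?f \<theta>) \<partial>lborel)"
    by (intro nn_integral_cong) (simp add: indicator_def)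
  have m: "(\<integral>\<^sup>+\<theta>\<in>{0..2 * pi}. ennreal (- h \<theta>) \<partial>lborel) = (\<integral>\<^sup>+\<theta>. ennreal (- ?f \<theta>) \<partial>lborel)"
    by (intro nn_integral_cong) (simp add: indicator_def)
  obtain A B where AB: "0 \<le> A" "0 \<le> B" "(\<integral>\<^sup>+\<theta>. ennreal (?f \<theta>) \<partial>lborel) = ennreal A"
     "(\<integral>\<^sup>+\<theta>. ennreal (- ?f \<theta>) \<partial>lborel) = ennreal B"
    by (rule integrableE[OF f])
  have "I = A - B"
    using real_lebesgue_integral_def[OF f] I AB by (simp add: set_lebesgue_integral_def)
  moreover have "circle_mean (\<lambda>z. ereal (g z)) a r = (ereal A - ereal B) / ereal (2 * pi)"
    unfolding circle_mean_def using p m AB by (simp add: h_def enn2ereal_ennreal)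
  ultimately show ?thesis by simp
qed

lemma holomorphic_mean_value:
  assumes "f holomorphic_on UNIV" "0 < r"
  shows "((\<lambda>\<theta>. f (a + of_real r * cis \<theta>)) has_integral 2 * of_real pi * f a) {0..2 * pi}"
proof -
  have "((\<lambda>u. f u/(u-a)) has_contour_integral (2 * of_real pi * \<i> * f a)) (circlepath a r)"
    by (rule Cauchy_integral_circlepath)
      (use assms in \<open>auto intro: holomorphic_on_subset holomorphic_on_imp_continuous_on\<close>)
  then have "((\<lambda>t. f (a + r * cis t) / (a + r * cis t - a) * r * \<i> * cis t) has_integral 2 * of_real pi * \<i> * f a) {0..2 * pi}"
    unfolding circlepath_def by (subst (asm) has_contour_integral_part_circlepath_iff) auto
  then have "((\<lambda>t. \<i> * f (a + r * cis t)) has_integral \<i> * (2 * of_real pi * f a)) {0..2 * pi}"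
    using assms(2) by (simp add: mult.commute mult.left_commute)
  from has_integral_mult_right[OF this, of "-\<i>"] show ?thesis by (simp flip: mult.assoc)
qed

lemma circle_mean_Re_holomorphic:
  assumes "f holomorphic_on UNIV" "0 < r"
  shows "circle_mean (\<lambda>z. ereal (Re (f z) + c)) a r = ereal (Re (f a) + c)"
proof -
  have 1: "((\<lambda>\<theta>. Re (f (a + of_real r * cis \<theta>)) + c) has_integral 2 * pi * (Re (f a) + c)) {0..2 * pi}"
    using has_integral_add[OF has_integral_linear[OF holomorphic_mean_value[OF assms] bounded_linear_Re]
        has_integral_const_real[of c 0 "2*pi"]] by (simp add: o_def algebra_simps)
  have "continuous_on UNIV f" using assms(1) by (rule holomorphic_on_imp_continuous_on)
  then have "continuous_on {0..2 * pi} (\<lambda>\<theta>. f (a + of_real r * cis \<theta>))"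
    by (rule continuous_on_compose2) (auto intro!: continuous_intros)
  then have "continuous_on {0..2 * pi} (\<lambda>\<theta>. Re (f (a + of_real r * cis \<theta>)) + c)"
    by (intro continuous_intros)
  from circle_mean_continuous[OF 1 this] show ?thesis by simp
qed

text \<open>This is the only way in which the sub-mean value inequality is exploited below: a bound by a
harmonic function plus a constant on a circle passes to the centre, because the mean of the real
part of an entire function is its value at the centre.  A quadratic function
$-\delta|z|^2$ equals a constant on a circle around \<open>0\<close>, which is how the constant \<open>c\<close> is
used to contradict the existence of interior maxima.\<close>

lemma subharmonic_le_harmonic_bound:
  assumes "subharmonic_on u S" "0 < r" "cball a r \<subseteq> S" "f holomorphic_on UNIV"
    and "\<And>z. dist a z = r \<Longrightarrow> u z \<le> ereal (Re (f z) + c)"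
  shows "u a \<le> ereal (Re (f a) + c)"
proof -
  have "u a \<le> circle_mean u a r" using assms(1-3) by (auto simp: subharmonic_on_def)
  also have "\<dots> \<le> circle_mean (\<lambda>z. ereal (Re (f z) + c)) a r"
    using assms(2,5) by (intro circle_mean_mono) auto
  finally show ?thesis using circle_mean_Re_holomorphic[OF assms(4,2)] by simp
qed

lemma usc_attains_sup:
  fixes f :: "'a::metric_space \<Rightarrow> ereal"
  assumes "compact C" "C \<noteq> {}" "usc_on f C"
  obtains x where "x \<in> C" "\<And>y. y \<in> C \<Longrightarrow> f y \<le> f x"
proof -
  have "\<exists>x\<in>C. \<forall>y\<in>C. f y \<le> f x"
  proof (rule ccontr)
    assume "\<not> ?thesis"
    then have "\<forall>x\<in>C. \<exists>y\<in>C. f x < f y" by (auto simp: not_le)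
    then obtain b where b: "\<And>x. x \<in> C \<Longrightarrow> b x \<in> C \<and> f x < f (b x)" by metis
    have "\<exists>U. open U \<and> x \<in> U \<and> (\<forall>y\<in>U\<inter>C. f y < f (b x))" if "x \<in> C" for x
    proof -
      have "\<forall>\<^sub>F y in at x within C. f y < f (b x)" using assms(3) b[OF that] that by (auto simp: usc_on_def)
      then obtain U where "open U" "x \<in> U" "\<forall>y\<in>U. y \<noteq> x \<longrightarrow> y \<in> C \<longrightarrow> f y < f (b x)"
        unfolding eventually_at_topological by auto
      then show ?thesis using b[OF that] by (intro exI[of _ U]) auto
    qed
    then obtain U where U: "\<And>x. x \<in> C \<Longrightarrow> open (U x) \<and> x \<in> U x \<and> (\<forall>y\<in>U x\<inter>C. f y < f (b x))" by metis
    have "C \<subseteq> (\<Union>x\<in>C. U x)" using U by auto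
    from compactE_image[OF assms(1) _ this] U
    obtain T where T: "T \<subseteq> C" "finite T" "C \<subseteq> (\<Union>x\<in>T. U x)" by metis
    have "T \<noteq> {}" using T assms(2) by auto
    define m where "m = Max ((\<lambda>x. f (b x)) ` T)"
    have "m \<in> (\<lambda>x. f (b x)) ` T" unfolding m_def using T \<open>T \<noteq> {}\<close> by (intro Max_in) auto
    then obtain x where x: "x \<in> T" "m = f (b x)" by auto
    then have "b x \<in> C" using b T by auto
    then obtain z where z: "z \<in> T" "b x \<in> U z" using T by auto
    then have "f (b x) < f (b z)" using U[of z] T \<open>b x \<in> C\<close> by auto
    also have "\<dots> \<le> m" unfolding m_def using z T by (intro Max_ge) auto
    finally show False using x by simp
  qed
  then show ?thesis using that by blast
qed

text \<open>Upper semicontinuity as relative openness of the strict sublevel sets; in this form it is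
stable under composition with continuous maps for free.\<close>

lemma usc_on_iff_open:
  "usc_on u S \<longleftrightarrow> (\<forall>c. \<exists>U. open U \<and> {x\<in>S. u x < c} = S \<inter> U)"
proof
  assume L: "usc_on u S"
  show "\<forall>c. \<exists>U. open U \<and> {x\<in>S. u x < c} = S \<inter> U"
  proof
    fix c
    have "\<exists>U. open U \<and> x \<in> U \<and> (\<forall>y\<in>U\<inter>S. u y < c)" if "x \<in> S" "u x < c" for x
    proof -
      have "\<forall>\<^sub>F y in at x within S. u y < c" using L that by (auto simp: usc_on_def)
      then obtain U where "open U" "x \<in> U" "\<forall>y\<in>U. y \<noteq> x \<longrightarrow> y \<in> S \<longrightarrow> u y < c"
        unfolding eventually_at_topological by auto
      then show ?thesis using that by (intro exI[of _ U]) auto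
    qed
    then obtain U where U: "\<And>x. x \<in> S \<Longrightarrow> u x < c \<Longrightarrow> open (U x) \<and> x \<in> U x \<and> (\<forall>y\<in>U x\<inter>S. u y < c)" by metis
    show "\<exists>U. open U \<and> {x\<in>S. u x < c} = S \<inter> U"
      using U by (intro exI[of _ "\<Union>x\<in>{x\<in>S. u x < c}. U x"]) auto
  qed
next
  assume R: "\<forall>c. \<exists>U. open U \<and> {x\<in>S. u x < c} = S \<inter> U"
  show "usc_on u S"
    unfolding usc_on_def
  proof (intro ballI allI impI)
    fix x c assume x: "x \<in> S" "u x < c"
    obtain U where U: "open U" "{x\<in>S. u x < c} = S \<inter> U" using R by blast
    then have "x \<in> U" using x by auto
    then show "\<forall>\<^sub>F y in at x within S. u y < c"
      unfolding eventually_at_topological using U by (intro exI[of _ U]) auto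
  qed
qed

lemma usc_on_compose:
  assumes "usc_on u S" "continuous_on T f" "f ` T \<subseteq> S"
  shows "usc_on (\<lambda>x. u (f x)) T"
  unfolding usc_on_iff_open
proof
  fix c
  obtain U where U: "open U" "{x\<in>S. u x < c} = S \<inter> U" using assms(1) unfolding usc_on_iff_open by blast
  obtain V where V: "open V" "V \<inter> T = f -` U \<inter> T"
    using assms(2) U(1) unfolding continuous_on_open_invariant by blast
  have "{x \<in> T. u (f x) < c} = T \<inter> V" using U V assms(3) by blast
  then show "\<exists>U. open U \<and> {x \<in> T. u (f x) < c} = T \<inter> U" using V by blast
qed

lemma usc_on_subset: "usc_on u S \<Longrightarrow> T \<subseteq> S \<Longrightarrow> usc_on u T"
  using usc_on_compose[of u S T "\<lambda>x. x"] by simp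

lemma usc_on_add_continuous:
  assumes "usc_on u S" "continuous_on S g"
  shows "usc_on (\<lambda>x. u x + ereal (g x)) S"
  unfolding usc_on_def
proof (intro ballI allI impI)
  fix x c assume x: "x \<in> S" "u x + ereal (g x) < c"
  then have "u x < c - ereal (g x)" by (simp add: ereal_less_minus_iff)
  then obtain e where e: "u x < ereal e" "ereal e < c - ereal (g x)"
    using ereal_dense2 by blast
  have 1: "\<forall>\<^sub>F y in at x within S. u y < ereal e" using assms(1) x e by (auto simp: usc_on_def)
  obtain k where k: "ereal e < ereal k" "ereal k < c - ereal (g x)" using ereal_dense2[OF e(2)] by blast
  have "(g \<longlongrightarrow> g x) (at x within S)" using assms(2) x by (simp add: continuous_on)
  from tendstoD[OF this, of "k - e"] k
  have 2: "\<forall>\<^sub>F y in at x within S. dist (g y) (g x) < k - e" by simp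
  show "\<forall>\<^sub>F y in at x within S. u y + ereal (g y) < c"
    using 1 2
  proof eventually_elim
    case (elim y)
    have "g y \<le> g x + (k - e)" using elim(2) by (simp add: dist_real_def)
    then have "u y + ereal (g y) \<le> ereal e + ereal (g x + (k - e))" using elim(1) by (intro add_mono) auto
    also have "\<dots> = ereal k + ereal (g x)" by simp
    also have "\<dots> < c" using k(2) by (simp add: ereal_less_minus_iff)
    finally show ?case .
  qed
qed

section \<open>The maximum principle on analytic discs\<close>

lemma continuous_on_scaleC_vec [continuous_intros]:
  fixes w :: "complex ^ 'n"
  assumes "continuous_on S f"
  shows "continuous_on S (\<lambda>x. f x *\<^sub>C w)"
  unfolding scaleC_vec_def scaleC_complex_def by (intro continuous_intros assms)

lemma scaleC_vec_component: "(c *\<^sub>C (x :: complex ^ 'n)) $ i = c * x $ i"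
  by (simp add: scaleC_vec_def scaleC_complex_def)

lemma norm_add_power2:
  fixes x y :: "'a::real_inner"
  shows "(norm (x + y))\<^sup>2 = (norm x)\<^sup>2 + 2 * (x \<bullet> y) + (norm y)\<^sup>2"
  by (simp add: power2_norm_eq_inner algebra_simps inner_commute)

lemma continuous_on_vec_componentwise:
  fixes f :: "'a::topological_space \<Rightarrow> ('b::topological_space) ^ 'n"
  assumes "\<And>i. continuous_on S (\<lambda>x. f x $ i)"
  shows "continuous_on S f"
  using continuous_on_vec_lambda[of S "\<lambda>i x. f x $ i", OF assms] by simp

lemma entire_vec_first_order:
  fixes P :: "complex \<Rightarrow> complex ^ 'n"
  assumes "\<And>i. (\<lambda>\<zeta>. P \<zeta> $ i) holomorphic_on UNIV" "0 < \<epsilon>"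
  shows "\<forall>\<^sub>F \<xi> in at 0. (norm (P (z + \<xi>) - P z - \<xi> *\<^sub>C (\<chi> i. deriv (\<lambda>\<zeta>. P \<zeta> $ i) z)))\<^sup>2 \<le> \<epsilon> * (norm \<xi>)\<^sup>2"
proof -
  define h where "h \<xi> = P (z + \<xi>) - P z - \<xi> *\<^sub>C (\<chi> i. deriv (\<lambda>\<zeta>. P \<zeta> $ i) z)" for \<xi>
  define N where "N = real CARD('n)"
  have N: "N > 0" by (simp add: N_def)
  have "\<forall>\<^sub>F \<xi> in at 0. norm (h \<xi> $ i) \<le> sqrt (\<epsilon> / N) * norm \<xi>" for i
  proof -
    let ?D = "deriv (\<lambda>\<zeta>. P \<zeta> $ i) z"
    have "((\<lambda>\<zeta>. P \<zeta> $ i) has_field_derivative ?D) (at z)"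
      by (rule holomorphic_derivI[OF assms(1)]) auto
    then have "((\<lambda>\<xi>. (P (z + \<xi>) $ i - P z $ i) / \<xi>) \<longlongrightarrow> ?D) (at 0)" by (simp add: DERIV_def)
    moreover have "sqrt (\<epsilon> / N) > 0" using assms(2) N by simp
    ultimately have "\<forall>\<^sub>F \<xi> in at 0. dist ((P (z + \<xi>) $ i - P z $ i) / \<xi>) ?D < sqrt (\<epsilon> / N)"
      by (rule tendstoD)
    then show ?thesis
      using eventually_neq_at_within[of 0]
    proof eventually_elim
      case (elim \<xi>)
      have "((P (z + \<xi>) $ i - P z $ i) / \<xi> - ?D) * \<xi> = h \<xi> $ i"
        using elim(2) unfolding left_diff_distrib[of "_ / \<xi>"] by (simp add: h_def scaleC_vec_component mult.commute)
      then have "norm (h \<xi> $ i) = norm (((P (z + \<xi>) $ i - P z $ i) / \<xi> - ?D) * \<xi>)" by simp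
      also have "\<dots> = dist ((P (z + \<xi>) $ i - P z $ i) / \<xi>) ?D * norm \<xi>"
        by (simp only: norm_mult dist_norm)
      also have "\<dots> \<le> sqrt (\<epsilon> / N) * norm \<xi>" using elim(1) by (intro mult_right_mono) auto
      finally show ?case .
    qed
  qed
  then have "\<forall>\<^sub>F \<xi> in at 0. \<forall>i. norm (h \<xi> $ i) \<le> sqrt (\<epsilon> / N) * norm \<xi>"
    by (simp add: eventually_all_finite)
  then show ?thesis
  proof eventually_elim
    case (elim \<xi>)
    have "(norm (h \<xi>))\<^sup>2 = (\<Sum>i\<in>UNIV. (norm (h \<xi> $ i))\<^sup>2)"
      by (simp add: norm_vec_def L2_set_def sum_nonneg)
    also have "\<dots> \<le> (\<Sum>i\<in>(UNIV :: 'n set). \<epsilon> / N * (norm \<xi>)\<^sup>2)"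
    proof (rule sum_mono)
      fix i
      have "(norm (h \<xi> $ i))\<^sup>2 \<le> (sqrt (\<epsilon> / N) * norm \<xi>)\<^sup>2" using elim by (intro power_mono) auto
      then show "(norm (h \<xi> $ i))\<^sup>2 \<le> \<epsilon> / N * (norm \<xi>)\<^sup>2"
        using assms(2) N by (simp add: power_mult_distrib real_sqrt_divide power_divide)
    qed
    also have "\<dots> = \<epsilon> * (norm \<xi>)\<^sup>2" using N by (simp add: N_def)
    finally show ?case by (simp add: h_def)
  qed
qed

text \<open>A plurisubharmonic function \<open>u\<close> is given as subharmonic on complex \<^emph>\<open>lines\<close>; here it is
compared with harmonic functions on a \<^emph>\<open>curved\<close> disc $\zeta \mapsto F(\zeta)$.  The comparison is a
doubling-of-variables argument.  If it
fails, let the disc move by a vertical vector \<open>v\<close> and maximize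
  $u(F(\zeta) + (0,v)) - \Re p(\zeta) + \frac m2 |\zeta|^2 - K|v|^2$.
For \<open>K\<close> large and small vertical moves, the maximum is attained at an interior point
$(\zeta_0,v_0)$.  Put $v(\xi) = v_0 - h(\xi)$, where \<open>h\<close> is the deviation of the disc from its
tangent line at $\zeta_0$: then the moved points run through a complex line, where \<open>u\<close> is
subharmonic.  In $|v(\xi)|^2 = |v_0|^2 - 2\langle v_0,h(\xi)\rangle + |h(\xi)|^2$ the middle term is
harmonic and vanishes at $\xi=0$, and the last one is $o(|\xi|^2)$, so the gain $\frac m2|\xi|^2$
wins and contradicts the sub-mean value inequality.\<close>

lemma psh_disc_max_principle:
  fixes u :: "(complex ^ 'r) \<times> (complex ^ 'n) \<Rightarrow> ereal"
  assumes psh: "plurisubharmonic_on u \<Omega>"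
    and holP: "\<And>i. (\<lambda>\<zeta>. P \<zeta> $ i) holomorphic_on UNIV" and holp: "p holomorphic_on UNIV"
    and in\<Omega>: "\<And>\<zeta>. norm \<zeta> \<le> 1 \<Longrightarrow> (a + \<zeta> *\<^sub>C w, P \<zeta>) \<in> \<Omega>"
    and bd: "\<And>\<zeta>. norm \<zeta> = 1 \<Longrightarrow> u (a + \<zeta> *\<^sub>C w, P \<zeta>) \<le> ereal (Re (p \<zeta>))"
    and z: "norm z \<le> 1"
  shows "u (a + z *\<^sub>C w, P z) \<le> ereal (Re (p z))"
proof (rule ccontr)
  assume neg: "\<not> ?thesis"
  define F where "F x = (a + fst x *\<^sub>C w, P (fst x) + snd x)" for x
  have contP: "continuous_on S P" for S
    by (intro continuous_on_vec_componentwise holomorphic_on_imp_continuous_on[OF holomorphic_on_subset[OF holP]]) auto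
  have contp: "continuous_on S p" for S
    by (intro holomorphic_on_imp_continuous_on holomorphic_on_subset[OF holp]) auto
  have contF: "continuous_on S F" for S
    unfolding F_def by (intro continuous_intros continuous_on_compose2[OF contP]) auto
  have open\<Omega>: "open \<Omega>" and usc: "usc_on u \<Omega>" and fin: "\<And>x. x \<in> \<Omega> \<Longrightarrow> u x < \<infinity>"
    using psh by (auto simp: plurisubharmonic_on_def)
  \<comment> \<open>The excess of \<open>u\<close> over \<open>Re p\<close> at the bad point \<open>z\<close>; it calibrates the quadratic terms.\<close>
  obtain e where e: "ereal (Re (p z)) < ereal e" "ereal e < u (F (z, 0))"
    using ereal_dense2[of "ereal (Re (p z))" "u (F (z, 0))"] neg by (auto simp: F_def not_le)
  define m where "m = e - Re (p z)"
  have m: "m > 0" using e by (simp add: m_def)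
  define W where "W = F -` \<Omega>"
  have openW: "open W" unfolding W_def using contF open\<Omega> by (intro open_vimage) auto
  define g where "g x = u (F x) + ereal (- Re (p (fst x)))" for x
  have uscW: "usc_on g W"
    unfolding g_def
  proof (rule usc_on_add_continuous)
    show "usc_on (\<lambda>x. u (F x)) W" by (rule usc_on_compose[OF usc contF]) (auto simp: W_def)
    show "continuous_on W (\<lambda>x. - Re (p (fst x)))"
      by (intro continuous_intros continuous_on_compose2[OF contp]) auto
  qed
  obtain U where U: "open U" "{x\<in>W. g x < ereal (m/2)} = W \<inter> U" using uscW unfolding usc_on_iff_open by blast
  have cK: "compact (cball (0::complex) 1 \<times> {0::complex ^ 'n})" "compact (sphere (0::complex) 1 \<times> {0::complex ^ 'n})"
    by (intro compact_Times; simp)+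
  have "cball 0 1 \<times> {0} \<subseteq> W" using in\<Omega> by (auto simp: W_def F_def)
  then obtain \<eta>1 where \<eta>1: "\<eta>1 > 0" "(\<Union>x\<in>cball 0 1 \<times> {0}. cball x \<eta>1) \<subseteq> W"
    using compact_subset_open_imp_cball_epsilon_subset[OF cK(1) openW] by metis
  have "x \<in> {x\<in>W. g x < ereal (m/2)}" if "x \<in> sphere 0 1 \<times> {0}" for x
  proof -
    obtain \<zeta> where \<zeta>: "x = (\<zeta>, 0)" "norm \<zeta> = 1" using \<open>x \<in> _\<close> by auto
    have "g x \<le> ereal (Re (p \<zeta>)) + ereal (- Re (p \<zeta>))"
      unfolding g_def using \<zeta> bd[of \<zeta>] by (intro add_mono) (auto simp: F_def)
    also have "\<dots> < ereal (m/2)" using m by simp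
    finally show ?thesis using \<zeta> in\<Omega>[of \<zeta>] by (simp add: W_def F_def)
  qed
  then have "sphere 0 1 \<times> {0} \<subseteq> W \<inter> U" unfolding U by blast
  then obtain \<eta>2 where \<eta>2: "\<eta>2 > 0" "(\<Union>x\<in>sphere 0 1 \<times> {0}. cball x \<eta>2) \<subseteq> W \<inter> U"
    using compact_subset_open_imp_cball_epsilon_subset[OF cK(2) open_Int[OF openW U(1)]] by metis
  \<comment> \<open>Moves of size up to \<open>\<eta>\<close> stay in \<open>\<Omega>\<close> and keep \<open>u - Re p\<close> below \<open>m/2\<close> over the unit circle.\<close>
  define \<eta> where "\<eta> = min \<eta>1 \<eta>2"
  have \<eta>: "\<eta> > 0" using \<eta>1 \<eta>2 by (simp add: \<eta>_def)
  have inW: "(\<zeta>, v) \<in> W" if "norm \<zeta> \<le> 1" "norm v \<le> \<eta>" for \<zeta> v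
  proof -
    have "(\<zeta>, v) \<in> cball (\<zeta>, 0) \<eta>1" using that by (simp add: dist_Pair_Pair \<eta>_def)
    then show ?thesis using \<eta>1(2) that by (force simp: subset_iff)
  qed
  have circ: "g (\<zeta>, v) < ereal (m/2)" if "norm \<zeta> = 1" "norm v \<le> \<eta>" for \<zeta> v
  proof -
    have "(\<zeta>, v) \<in> cball (\<zeta>, 0) \<eta>2" using that by (simp add: dist_Pair_Pair \<eta>_def)
    then have "(\<zeta>, v) \<in> W \<inter> U" using \<eta>2(2) that by (force simp: subset_iff)
    then show ?thesis using U by blast
  qed
  define C where "C = cball (0::complex) 1 \<times> cball (0 :: complex ^ 'n) \<eta>"
  have C: "compact C" "C \<noteq> {}" "C \<subseteq> W" "(z, 0) \<in> C"
    using \<eta> z inW unfolding C_def by (auto intro!: compact_Times)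
  obtain x1 where x1: "x1 \<in> C" "\<And>y. y \<in> C \<Longrightarrow> g y \<le> g x1"
    using usc_attains_sup[OF C(1,2) usc_on_subset[OF uscW C(3)]] by metis
  have gfin: "g x < \<infinity>" if "x \<in> W" for x
    using fin[of "F x"] that by (auto simp: W_def g_def)
  obtain M where M: "g x1 < ereal M" using ereal_dense2[OF gfin[of x1]] x1 C by blast
  have gM: "g x \<le> ereal M" if "x \<in> C" for x using x1(2)[OF that] M by (simp add: less_imp_le order.trans)
  \<comment> \<open>\<open>K\<close> makes the penalty at \<open>norm v = \<eta>\<close> outweigh every value of \<open>u - Re p\<close>, so no maximum lies there.\<close>
  define K where "K = \<bar>M\<bar> / \<eta>\<^sup>2"
  have K: "K \<ge> 0" "K * \<eta>\<^sup>2 \<ge> M" using \<eta> by (auto simp: K_def)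
  define b where "b x = m/2 * (norm (fst x))\<^sup>2 - K * (norm (snd x))\<^sup>2" for x :: "complex \<times> (complex ^ 'n)"
  have "usc_on (\<lambda>x. g x + ereal (b x)) C"
    unfolding b_def by (intro usc_on_add_continuous usc_on_subset[OF uscW C(3)] continuous_intros)
  from usc_attains_sup[OF C(1,2) this]
  obtain x0 where x0: "x0 \<in> C" and max: "\<And>y. y \<in> C \<Longrightarrow> g y + ereal (b y) \<le> g x0 + ereal (b x0)"
    by blast
  obtain \<zeta> v where [simp]: "x0 = (\<zeta>, v)" by (cases x0)
  have "ereal m \<le> g (z, 0)"
    using e(2) unfolding g_def m_def by (cases "u (F (z, 0))") auto
  moreover have "g (z, 0) \<le> g (z, 0) + ereal (b (z, 0))" using m by (cases "g (z, 0)") (auto simp: b_def)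
  ultimately have big: "ereal m \<le> g x0 + ereal (b x0)" using max[OF C(4)] by (meson order.trans)
  have "norm \<zeta> \<le> 1" "norm v \<le> \<eta>" using x0 by (auto simp: C_def)
  have "norm \<zeta> \<noteq> 1"
  proof
    assume 1: "norm \<zeta> = 1"
    have "g x0 + ereal (b x0) < ereal (m/2) + ereal (m/2)"
      using circ[OF 1 \<open>norm v \<le> \<eta>\<close>] mult_nonneg_nonneg[OF K(1) zero_le_power2[of "norm v"]] 1
      by (cases "g x0") (auto simp: b_def)
    then show False using big by simp
  qed
  then have z1: "norm \<zeta> < 1" using \<open>norm \<zeta> \<le> 1\<close> by simp
  have "norm v \<noteq> \<eta>"
  proof
    assume 1: "norm v = \<eta>"
    have "g x0 + ereal (b x0) \<le> ereal M + ereal (m/2 - M)"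
    proof (intro add_mono gM x0)
      have "m/2 * (norm \<zeta>)\<^sup>2 \<le> m/2 * 1" using z1 m by (intro mult_left_mono power_le_one) auto
      then show "ereal (b x0) \<le> ereal (m/2 - M)" using K 1 by (simp add: b_def)
    qed
    then show False using order.trans[OF big] m by fastforce
  qed
  then have v1: "norm v < \<eta>" using \<open>norm v \<le> \<eta>\<close> by simp
  obtain V where V: "g x0 + ereal (b x0) = ereal V"
    using big gfin[of x0] x0 C by (cases "g x0") auto
  have u0: "u (F x0) = ereal (V + Re (p \<zeta>) - b x0)"
    using V by (cases "u (F x0)") (auto simp: g_def)
  have ule: "u (F (\<xi>, y)) \<le> ereal (V + Re (p \<xi>) - b (\<xi>, y))" if "norm \<xi> \<le> 1" "norm y \<le> \<eta>" for \<xi> y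
    using max[of "(\<xi>, y)"] that unfolding V by (cases "u (F (\<xi>, y))") (auto simp: g_def C_def)
  define d where "d = (\<chi> i. deriv (\<lambda>\<zeta>. P \<zeta> $ i) \<zeta>)"
  define h where "h \<xi> = P (\<zeta> + \<xi>) - P \<zeta> - \<xi> *\<^sub>C d" for \<xi>
  have conth: "continuous_on S h" for S
    unfolding h_def by (intro continuous_intros continuous_on_compose2[OF contP]) auto
  have h0: "h 0 = 0" by (simp add: h_def vec_eq_iff scaleC_vec_component)
  have "isCont h 0" using conth[of UNIV] by (simp add: continuous_on_eq_continuous_at)
  have "((\<lambda>\<xi>. norm (\<zeta> + \<xi>)) \<longlongrightarrow> norm (\<zeta> + 0)) (at 0)" by (intro tendsto_intros)
  then have ev1: "\<forall>\<^sub>F \<xi> in at 0. norm (\<zeta> + \<xi>) < 1" using z1 by (intro order_tendstoD) auto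
  have "((\<lambda>\<xi>. norm (v - h \<xi>)) \<longlongrightarrow> norm (v - h 0)) (at 0)"
    using \<open>isCont h 0\<close> by (intro tendsto_intros) (simp add: isCont_def)
  then have ev2: "\<forall>\<^sub>F \<xi> in at 0. norm (v - h \<xi>) < \<eta>" using v1 h0 by (intro order_tendstoD) auto
  have "0 < m / (4 * (K + 1))" using m K by simp
  from entire_vec_first_order[OF holP this, of \<zeta>]
  have ev3: "\<forall>\<^sub>F \<xi> in at 0. (norm (h \<xi>))\<^sup>2 \<le> m / (4 * (K + 1)) * (norm \<xi>)\<^sup>2"
    by (simp add: h_def d_def)
  have "\<forall>\<^sub>F \<xi> in at 0. norm (\<zeta> + \<xi>) < 1 \<and> norm (v - h \<xi>) < \<eta> \<and> (norm (h \<xi>))\<^sup>2 \<le> m / (4 * (K + 1)) * (norm \<xi>)\<^sup>2"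
    by (intro eventually_conj ev1 ev2 ev3)
  then obtain r0 where r0: "r0 > 0" "\<And>\<xi>. \<xi> \<noteq> 0 \<Longrightarrow> norm \<xi> < r0 \<Longrightarrow> norm (\<zeta> + \<xi>) < 1 \<and> norm (v - h \<xi>) < \<eta> \<and> (norm (h \<xi>))\<^sup>2 \<le> m / (4 * (K + 1)) * (norm \<xi>)\<^sup>2"
    unfolding eventually_at by (auto simp: dist_norm)
  define r where "r = r0 / 2"
  have r: "r > 0" "r < r0" using r0 by (auto simp: r_def)
  \<comment> \<open>\<open>H\<close> collects the harmonic part of the bound along the tangent line; the strictly negative
    remainder is accounted for in \<open>c\<close>.\<close>
  define H where "H \<xi> = p (\<zeta> + \<xi>) - of_real m * cnj \<zeta> * \<xi> - of_real (2 * K) * (\<Sum>i\<in>UNIV. cnj (v $ i) * h \<xi> $ i)" for \<xi>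
  define c where "c = V - b x0 - m / 4 * r\<^sup>2"
  \<comment> \<open>The choice of the vertical move turns the disc into its own tangent line.\<close>
  have line: "F x0 + \<xi> *\<^sub>C (w, d) = F (\<zeta> + \<xi>, v - h \<xi>)" for \<xi>
    by (simp add: F_def h_def scaleC_prod_def scaleC_add_left)
  have "u (F x0 + 0 *\<^sub>C (w, d)) \<le> ereal (Re (H 0) + c)"
  proof (rule subharmonic_le_harmonic_bound[where a = 0 and u = "\<lambda>\<xi>. u (F x0 + \<xi> *\<^sub>C (w, d))"
        and f = H and r = r and S = "{\<xi>. F x0 + \<xi> *\<^sub>C (w, d) \<in> \<Omega>}"])
    show "subharmonic_on (\<lambda>\<xi>. u (F x0 + \<xi> *\<^sub>C (w, d))) {\<xi>. F x0 + \<xi> *\<^sub>C (w, d) \<in> \<Omega>}"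
      using psh x0 C by (auto simp: plurisubharmonic_on_def W_def)
    show "cball 0 r \<subseteq> {\<xi>. F x0 + \<xi> *\<^sub>C (w, d) \<in> \<Omega>}"
    proof
      fix \<xi> assume "\<xi> \<in> cball (0::complex) r"
      then have "norm (\<zeta> + \<xi>) \<le> 1 \<and> norm (v - h \<xi>) \<le> \<eta>"
        using r0(2)[of \<xi>] r z1 v1 h0 by (cases "\<xi> = 0") auto
      then show "\<xi> \<in> {\<xi>. F x0 + \<xi> *\<^sub>C (w, d) \<in> \<Omega>}" using inW unfolding line by (simp add: W_def)
    qed
    have shift: "(\<lambda>\<xi>. f (\<zeta> + \<xi>)) holomorphic_on UNIV" if "f holomorphic_on UNIV" for f
    proof -
      have "(\<lambda>\<xi>. \<zeta> + \<xi>) holomorphic_on UNIV" by (intro holomorphic_intros)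
      from holomorphic_on_compose_gen[OF this that] show ?thesis by (simp add: o_def)
    qed
    have "(\<lambda>\<xi>. h \<xi> $ i) holomorphic_on UNIV" for i
      using shift[OF holP[of i]] by (auto simp: h_def scaleC_vec_component intro!: holomorphic_intros)
    moreover have "(\<lambda>\<xi>. p (\<zeta> + \<xi>)) holomorphic_on UNIV" by (rule shift[OF holp])
    ultimately show "H holomorphic_on UNIV"
      unfolding H_def by (auto intro!: holomorphic_intros)
    fix \<xi> :: complex assume "dist 0 \<xi> = r"
    then have nr: "norm \<xi> = r" by simp
    then have ins: "norm (\<zeta> + \<xi>) \<le> 1" "norm (v - h \<xi>) \<le> \<eta>" "(norm (h \<xi>))\<^sup>2 \<le> m / (4 * (K + 1)) * r\<^sup>2"
      using r0(2)[of \<xi>] r by auto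
    have "K * (norm (h \<xi>))\<^sup>2 \<le> (K + 1) * (norm (h \<xi>))\<^sup>2" by (intro mult_right_mono) auto
    also have "\<dots> \<le> (K + 1) * (m / (4 * (K + 1)) * r\<^sup>2)" using ins(3) K by (intro mult_left_mono) auto
    also have "\<dots> = m / 4 * r\<^sup>2" using K(1) by (simp add: divide_simps add_nonneg_eq_0_iff)
    finally have Kh: "K * (norm (h \<xi>))\<^sup>2 \<le> m / 4 * r\<^sup>2" .
    have n1: "(norm (\<zeta> + \<xi>))\<^sup>2 = (norm \<zeta>)\<^sup>2 + 2 * Re (cnj \<zeta> * \<xi>) + r\<^sup>2"
      using nr by (simp add: norm_add_power2 inner_complex_def)
    have n2: "(norm (v - h \<xi>))\<^sup>2 = (norm v)\<^sup>2 - 2 * Re (\<Sum>i\<in>UNIV. cnj (v $ i) * h \<xi> $ i) + (norm (h \<xi>))\<^sup>2"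
    proof -
      have "v \<bullet> h \<xi> = Re (\<Sum>i\<in>UNIV. cnj (v $ i) * h \<xi> $ i)" by (simp add: inner_vec_def inner_complex_def)
      then show ?thesis using norm_add_power2[of v "- h \<xi>"] by simp
    qed
    have "V + Re (p (\<zeta> + \<xi>)) - b (\<zeta> + \<xi>, v - h \<xi>) = Re (H \<xi>) + (V - b x0 - m/2 * r\<^sup>2 + K * (norm (h \<xi>))\<^sup>2)"
      unfolding b_def fst_conv snd_conv \<open>x0 = (\<zeta>, v)\<close> n1 n2 H_def by (simp add: algebra_simps del: Re_sum)
    also have "\<dots> \<le> Re (H \<xi>) + c" using Kh by (simp add: c_def)
    finally show "u (F x0 + \<xi> *\<^sub>C (w, d)) \<le> ereal (Re (H \<xi>) + c)"
      unfolding line using ule[OF ins(1,2)] by (meson ereal_less_eq(3) order.trans)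
  qed (use r in auto)
  also have "F x0 + 0 *\<^sub>C (w, d) = F x0" unfolding line by (simp add: h0)
  also have "u (F x0) = ereal (V + Re (p \<zeta>) - b x0)" by (rule u0)
  finally show False using mult_pos_pos[OF m zero_less_power[OF r(1), of 2]] by (simp add: H_def h0 c_def)
qed

section \<open>Harmonic extension of polynomial boundary values\<close>

text \<open>Polynomials in $z$ and $\bar z$ with complex coefficients.  On the unit circle
$\bar z = 1/z$, so the real part of a monomial $c z^a \bar z^b$ is there the real part of a
holomorphic monomial; this gives holomorphic discs with prescribed real parts on the circle
without solving a Dirichlet problem.\<close>

inductive zbar_poly :: "(complex \<Rightarrow> complex) \<Rightarrow> bool" where
  mono: "zbar_poly (\<lambda>z. c * z ^ a * cnj z ^ b)"
| add: "zbar_poly f \<Longrightarrow> zbar_poly g \<Longrightarrow> zbar_poly (\<lambda>z. f z + g z)"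

lemma zbar_poly_mult:
  assumes "zbar_poly f" "zbar_poly g"
  shows "zbar_poly (\<lambda>z. f z * g z)"
  using assms
proof (induction rule: zbar_poly.induct)
  case (mono c a b)
  then show ?case
  proof (induction rule: zbar_poly.induct)
    case (mono c' a' b')
    show ?case using zbar_poly.mono[of "c * c'" "a + a'" "b + b'"] by (simp add: power_add mult_ac)
  next
    case (add f g)
    then show ?case using zbar_poly.add by (simp add: distrib_left)
  qed
next
  case (add f g)
  then show ?case using zbar_poly.add by (simp add: distrib_right)
qed

lemma zbar_poly_real_polynomial:
  assumes "real_polynomial_function q"
  shows "zbar_poly (\<lambda>z. of_real (q z))"
  using assms
proof (induction rule: real_polynomial_function.induct)
  case (linear f)
  interpret bounded_linear f by fact
  have split: "A * ((x + y) / 2) - j * B * ((x - y) / 2) = (A - j * B) / 2 * x ^ 1 * y ^ 0 + (A + j * B) / 2 * x ^ 0 * y ^ 1"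
    for A B x y j :: complex
    by (simp add: field_simps)
  have "of_real (f z) = (of_real (f 1) - \<i> * of_real (f \<i>)) / 2 * z ^ 1 * cnj z ^ 0
      + (of_real (f 1) + \<i> * of_real (f \<i>)) / 2 * z ^ 0 * cnj z ^ 1" for z
  proof -
    have "f z = f (Re z *\<^sub>R 1 + Im z *\<^sub>R \<i>)" by (rule arg_cong[of _ _ f]) (simp add: complex_eq_iff)
    also have "\<dots> = Re z * f 1 + Im z * f \<i>" by (simp add: add scaleR)
    finally have "of_real (f z) = of_real (f 1) * ((z + cnj z) / 2) - \<i> * of_real (f \<i>) * ((z - cnj z) / 2)"
      unfolding complex_add_cnj complex_diff_cnj by (simp add: complex_eq_iff)
    also have "\<dots> = (of_real (f 1) - \<i> * of_real (f \<i>)) / 2 * z ^ 1 * cnj z ^ 0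
      + (of_real (f 1) + \<i> * of_real (f \<i>)) / 2 * z ^ 0 * cnj z ^ 1"
      by (rule split)
    finally show ?thesis .
  qed
  then have "(\<lambda>z. complex_of_real (f z)) = (\<lambda>z. (of_real (f 1) - \<i> * of_real (f \<i>)) / 2 * z ^ 1 * cnj z ^ 0
      + (of_real (f 1) + \<i> * of_real (f \<i>)) / 2 * z ^ 0 * cnj z ^ 1)" by (rule ext)
  then show ?case by (rule ssubst) (rule zbar_poly.add[OF zbar_poly.mono zbar_poly.mono])
next
  case (const c)
  show ?case using zbar_poly.mono[of "of_real c" 0 0] by simp
next
  case (add f g)
  then show ?case using zbar_poly.add by simp
next
  case (mult f g)
  then show ?case using zbar_poly_mult by simp
qed

text \<open>The parameter \<open>s\<close> is the radius of the circle from which the boundary values are taken.  The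
extensions depend continuously on \<open>s\<close>, and at \<open>s = 0\<close> they degenerate to a constant real part:
this is what makes them a deformation from a point to the disc of interest.\<close>

lemma zbar_poly_harmonic_extension:
  assumes "zbar_poly f"
  shows "\<exists>P :: real \<Rightarrow> complex \<Rightarrow> complex. continuous_on UNIV (\<lambda>x. P (fst x) (snd x)) \<and> (\<forall>s. P s holomorphic_on UNIV) \<and>
     (\<forall>s z. norm z = 1 \<longrightarrow> Re (P s z) = Re (f (of_real s * z))) \<and> (\<forall>z. Re (P 0 z) = Re (f 0))"
  using assms
proof (induction rule: zbar_poly.induct)
  case (mono c a b)
  define P where "P s z = (if b \<le> a then c * of_real s ^ (a + b) * z ^ (a - b) else cnj c * of_real s ^ (a + b) * z ^ (b - a))"
    for s :: real and z :: complex
  have "Re (P s z) = Re (c * (of_real s * z) ^ a * cnj (of_real s * z) ^ b)" if "norm z = 1" for s z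
  proof -
    have 1: "z ^ k * cnj z ^ k = 1" for k
      using that by (simp flip: power_mult_distrib complex_norm_square)
    show ?thesis
    proof (cases "b \<le> a")
      case True
      have "z ^ a * cnj z ^ b = z ^ (a - b) * (z ^ b * cnj z ^ b)"
        using True by (simp flip: power_add mult.assoc)
      then have "c * (of_real s * z) ^ a * cnj (of_real s * z) ^ b = P s z"
        unfolding 1 using True by (simp add: P_def power_mult_distrib power_add mult_ac)
      then show ?thesis by simp
    next
      case False
      have "cnj z ^ b * z ^ a = cnj z ^ (b - a) * (z ^ a * cnj z ^ a)"
        using False by (simp flip: power_add mult.assoc add: mult.commute[of "z ^ a"])
      then have "c * (of_real s * z) ^ a * cnj (of_real s * z) ^ b = cnj (P s z)"
        unfolding 1 using False by (simp add: P_def power_mult_distrib power_add mult_ac)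
      then show ?thesis by simp
    qed
  qed
  moreover have "Re (P 0 z) = Re (c * 0 ^ a * cnj 0 ^ b)" for z
    by (cases "a = 0"; cases "b = 0") (auto simp: P_def power_0_left)
  moreover have "continuous_on UNIV (\<lambda>x. P (fst x) (snd x))"
    unfolding P_def by (cases "b \<le> a") (auto intro!: continuous_intros)
  moreover have "P s holomorphic_on UNIV" for s
    unfolding P_def by (cases "b \<le> a") (auto intro!: holomorphic_intros)
  ultimately show ?case by (intro exI[of _ P]) auto
next
  case (add f g)
  from add.IH(1) obtain P :: "real \<Rightarrow> complex \<Rightarrow> complex" where
    P: "continuous_on UNIV (\<lambda>x. P (fst x) (snd x)) \<and> (\<forall>s. P s holomorphic_on UNIV) \<and>
     (\<forall>s z. norm z = 1 \<longrightarrow> Re (P s z) = Re (f (of_real s * z))) \<and> (\<forall>z. Re (P 0 z) = Re (f 0))" by (rule exE)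
  from add.IH(2) obtain Q :: "real \<Rightarrow> complex \<Rightarrow> complex" where
    Q: "continuous_on UNIV (\<lambda>x. Q (fst x) (snd x)) \<and> (\<forall>s. Q s holomorphic_on UNIV) \<and>
     (\<forall>s z. norm z = 1 \<longrightarrow> Re (Q s z) = Re (g (of_real s * z))) \<and> (\<forall>z. Re (Q 0 z) = Re (g 0))" by (rule exE)
  from P Q show ?case
    by (intro exI[of _ "\<lambda>s z. P s z + Q s z"]) (auto intro!: continuous_intros holomorphic_intros)
qed

lemma real_polynomial_harmonic_extension:
  fixes q :: "complex \<Rightarrow> real"
  assumes "real_polynomial_function q"
  obtains P :: "real \<Rightarrow> complex \<Rightarrow> complex"
  where "continuous_on UNIV (\<lambda>x. P (fst x) (snd x))" "\<And>s. P s holomorphic_on UNIV"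
    "\<And>s z. norm z = 1 \<Longrightarrow> Re (P s z) = q (of_real s * z)" "\<And>z. Re (P 0 z) = q 0"
  using zbar_poly_harmonic_extension[OF zbar_poly_real_polynomial[OF assms]] by auto

section \<open>Harmonic majorants of upper semicontinuous functions\<close>

text \<open>Sup-convolution: $g_k(x) = \sup_{y \in S}\,(\max(v(y),-k) - k|x-y|)$ is \<open>k\<close>-Lipschitz on the whole
space, and decreases to \<open>v\<close> on \<open>S\<close> because points \<open>y\<close> away from \<open>x\<close> are penalized more and more
while \<open>v\<close> is bounded above.  Truncation at \<open>-k\<close> takes care of the value \<open>-\<infinity>\<close>.\<close>

lemma usc_decreasing_continuous_limit:
  fixes v :: "'a::real_normed_vector \<Rightarrow> ereal"
  assumes usc: "usc_on v S" and S: "compact S" "S \<noteq> {}" and fin: "\<And>x. x \<in> S \<Longrightarrow> v x < \<infinity>"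
  obtains g :: "nat \<Rightarrow> 'a \<Rightarrow> real"
  where "\<And>k. continuous_on UNIV (g k)" "\<And>k x. g (Suc k) x \<le> g k x"
    "\<And>k x. x \<in> S \<Longrightarrow> v x \<le> ereal (g k x)" "\<And>x. x \<in> S \<Longrightarrow> (\<lambda>k. ereal (g k x)) \<longlonglongrightarrow> v x"
proof -
  obtain x1 where x1: "x1 \<in> S" "\<And>y. y \<in> S \<Longrightarrow> v y \<le> v x1"
    using usc_attains_sup[OF S usc] by blast
  obtain B0 where B0: "v x1 < ereal B0" using ereal_dense2[OF fin[OF x1(1)]] by blast
  define B where "B = \<bar>B0\<bar>"
  have vB: "v y \<le> ereal B" if "y \<in> S" for y
  proof -
    have "v y \<le> ereal B0" using x1(2)[OF that] B0 by simp
    also have "\<dots> \<le> ereal B" by (simp add: B_def)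
    finally show ?thesis .
  qed
  define V where "V k y = real_of_ereal (max (v y) (- ereal (real k)))" for k y
  have eV: "ereal (V k y) = max (v y) (- ereal (real k))" if "y \<in> S" for k y
    using vB[OF that] by (cases "v y") (auto simp: V_def max_def)
  have VB: "V k y \<le> B" if "y \<in> S" for k y
  proof -
    have "ereal (V k y) \<le> ereal B" unfolding eV[OF that] using vB[OF that] by (simp add: B_def)
    then show ?thesis by simp
  qed
  define g where "g k x = (SUP y\<in>S. V k y - real k * norm (x - y))" for k x
  have VB': "V k y - real k * norm (x - y) \<le> B" if "y \<in> S" for k x y
    using VB[OF that, of k] mult_nonneg_nonneg[of "real k" "norm (x - y)"] by (simp add: algebra_simps add_increasing2)
  have bdd: "bdd_above ((\<lambda>y. V k y - real k * norm (x - y)) ` S)" for k x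
    using VB' by (intro bdd_aboveI2)
  have ge: "V k y - real k * norm (x - y) \<le> g k x" if "y \<in> S" for k x y
    unfolding g_def by (rule cSUP_upper[OF that bdd])
  have le: "g k x \<le> c" if "\<And>y. y \<in> S \<Longrightarrow> V k y - real k * norm (x - y) \<le> c" for k x c
    unfolding g_def by (rule cSUP_least[OF S(2) that])
  have lip: "g k x \<le> g k y + real k * norm (x - y)" for k x y
  proof (rule le)
    fix z assume "z \<in> S"
    have "norm (y - z) \<le> norm (x - y) + norm (x - z)"
      using norm_triangle_ineq[of "y - x" "x - z"] by (simp add: norm_minus_commute)
    then have "real k * norm (y - z) \<le> real k * norm (x - y) + real k * norm (x - z)"
      by (metis distrib_left mult_left_mono of_nat_0_le_iff)
    then show "V k z - real k * norm (x - z) \<le> g k y + real k * norm (x - y)"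
      using ge[OF \<open>z \<in> S\<close>, of k y] by linarith
  qed
  have cont: "continuous_on UNIV (g k)" for k
  proof (rule lipschitz_on_continuous_on)
    show "(real k)-lipschitz_on UNIV (g k)"
    proof (rule lipschitz_onI)
      fix x y
      show "dist (g k x) (g k y) \<le> real k * dist x y"
        using lip[of k x y] lip[of k y x] by (simp add: dist_norm norm_minus_commute abs_le_iff)
    qed simp
  qed
  have dec: "g (Suc k) x \<le> g k x" for k x
  proof (rule le)
    fix y assume y: "y \<in> S"
    have "ereal (V (Suc k) y) \<le> ereal (V k y)" unfolding eV[OF y] by (intro max.mono) auto
    then have "V (Suc k) y - real (Suc k) * norm (x - y) \<le> V k y - real k * norm (x - y)"
      by (simp add: algebra_simps add_increasing2)
    then show "V (Suc k) y - real (Suc k) * norm (x - y) \<le> g k x" using ge[OF y] by (rule order.trans)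
  qed
  have vg: "v x \<le> ereal (g k x)" if "x \<in> S" for k x
  proof -
    have "v x \<le> ereal (V k x)" unfolding eV[OF that] by simp
    also have "\<dots> \<le> ereal (g k x)" using ge[OF that, of k x] by simp
    finally show ?thesis .
  qed
  have lim: "(\<lambda>k. ereal (g k x)) \<longlonglongrightarrow> v x" if x: "x \<in> S" for x
  proof (rule order_tendstoI)
    fix c assume "c < v x"
    then show "\<forall>\<^sub>F k in sequentially. c < ereal (g k x)" using less_le_trans[OF _ vg[OF x]] by auto
  next
    fix c assume "v x < c"
    then obtain e where e: "v x < ereal e" "ereal e < c" using ereal_dense2 by blast
    have "\<forall>\<^sub>F y in at x within S. v y < ereal e" using usc x e by (auto simp: usc_on_def)
    then obtain d where d: "d > 0" "\<And>y. y \<in> S \<Longrightarrow> y \<noteq> x \<Longrightarrow> dist y x < d \<Longrightarrow> v y < ereal e"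
      unfolding eventually_at by auto
    have 1: "\<forall>\<^sub>F k in sequentially. real k \<ge> - e"
      by (rule filterlim_real_sequentially[THEN filterlim_at_top[THEN iffD1], rule_format])
    have 2: "\<forall>\<^sub>F k in sequentially. real k \<ge> (B - e) / d"
      by (rule filterlim_real_sequentially[THEN filterlim_at_top[THEN iffD1], rule_format])
    show "\<forall>\<^sub>F k in sequentially. ereal (g k x) < c"
      using 1 2
    proof eventually_elim
      case (elim k)
      have "g k x \<le> e"
      proof (rule le)
        fix y assume y: "y \<in> S"
        show "V k y - real k * norm (x - y) \<le> e"
        proof (cases "dist y x < d")
          case True
          then have "v y < ereal e" using d(2)[OF y] e(1) by (cases "y = x") auto
          then have "ereal (V k y) \<le> ereal e" unfolding eV[OF y] using elim(1) by simp
          then show ?thesis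
            using mult_nonneg_nonneg[of "real k" "norm (x - y)"] by (simp add: algebra_simps add_increasing2)
        next
          case False
          have "B - e \<le> real k * d" using elim(2) d(1) by (simp add: field_simps)
          also have "\<dots> \<le> real k * norm (x - y)"
            using False by (intro mult_left_mono) (auto simp: dist_norm norm_minus_commute)
          finally show ?thesis using VB[OF y, of k] by linarith
        qed
      qed
      then show ?case using e(2) by (meson ereal_less_eq(3) le_less_trans)
    qed
  qed
  show ?thesis using that[of g] cont dec vg lim by blast
qed

text \<open>The positive parts are dominated by the first one, which is integrable; the negative
parts increase.  The difference of the limits is defined since the first limit is finite.\<close>

lemma circle_mean_decreasing_limit:
  fixes g :: "nat \<Rightarrow> complex \<Rightarrow> real"
  assumes cont: "\<And>k. continuous_on UNIV (g k)" and dec: "\<And>k x. g (Suc k) x \<le> g k x"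
    and lim: "\<And>x. x \<in> sphere 0 1 \<Longrightarrow> (\<lambda>k. ereal (g k x)) \<longlonglongrightarrow> v x"
  shows "(\<lambda>k. circle_mean (\<lambda>z. ereal (g k z)) 0 1) \<longlonglongrightarrow> circle_mean v 0 1"
proof -
  have decs: "g j x \<le> g i x" if "i \<le> j" for i j x
    using lift_Suc_antimono_le[of "\<lambda>k. g k x", OF dec that] .
  have lim': "(\<lambda>k. ereal (g k (0 + of_real 1 * cis \<theta>))) \<longlonglongrightarrow> v (0 + of_real 1 * cis \<theta>)" for \<theta>
    by (intro lim) simp
  have cont': "continuous_on S (\<lambda>\<theta>. g k (0 + of_real 1 * cis \<theta>))" for k S
    by (intro continuous_on_compose2[OF cont]) (auto intro!: continuous_intros)
  have meas [measurable]: "(\<lambda>\<theta>. g k (0 + of_real 1 * cis \<theta>)) \<in> borel_measurable lborel" for k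
    using borel_measurable_continuous_onI[OF cont'[of UNIV]] by simp
  define A where "A k = (\<integral>\<^sup>+\<theta>\<in>{0..2 * pi}. e2ennreal (ereal (g k (0 + of_real 1 * cis \<theta>))) \<partial>lborel)" for k
  define A' where "A' = (\<integral>\<^sup>+\<theta>\<in>{0..2 * pi}. e2ennreal (v (0 + of_real 1 * cis \<theta>)) \<partial>lborel)"
  define B where "B k = (\<integral>\<^sup>+\<theta>\<in>{0..2 * pi}. e2ennreal (- ereal (g k (0 + of_real 1 * cis \<theta>))) \<partial>lborel)" for k
  define B' where "B' = (\<integral>\<^sup>+\<theta>\<in>{0..2 * pi}. e2ennreal (- v (0 + of_real 1 * cis \<theta>)) \<partial>lborel)"
  have limA: "(\<lambda>k. e2ennreal (ereal (g k (0 + of_real 1 * cis \<theta>))) * indicator {0..2 * pi} \<theta>)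
      \<longlonglongrightarrow> e2ennreal (v (0 + of_real 1 * cis \<theta>)) * indicator {0..2 * pi} \<theta>" for \<theta>
    by (cases "\<theta> \<in> {0..2 * pi}") (use tendsto_e2ennrealI[OF lim'[of \<theta>]] in auto)
  have limB: "(\<lambda>k. e2ennreal (- ereal (g k (0 + of_real 1 * cis \<theta>))) * indicator {0..2 * pi} \<theta>)
      \<longlonglongrightarrow> e2ennreal (- v (0 + of_real 1 * cis \<theta>)) * indicator {0..2 * pi} \<theta>" for \<theta>
  proof (cases "\<theta> \<in> {0..2 * pi}")
    case True
    then show ?thesis using tendsto_e2ennrealI[OF tendsto_uminus_ereal[OF lim'[of \<theta>]]] by simp
  qed simp
  have A0: "A 0 < \<infinity>"
  proof -
    have "integrable lborel (\<lambda>\<theta>. indicator {0..2 * pi} \<theta> *\<^sub>R g 0 (0 + of_real 1 * cis \<theta>))"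
      using borel_integrable_compact[OF compact_Icc cont'] by (simp add: indicator_scaleR_eq_if)
    then have "(\<integral>\<^sup>+\<theta>. ennreal (indicator {0..2 * pi} \<theta> *\<^sub>R g 0 (0 + of_real 1 * cis \<theta>)) \<partial>lborel) < \<infinity>"
      unfolding real_integrable_def by (auto simp: less_top)
    moreover have "A 0 = (\<integral>\<^sup>+\<theta>. ennreal (indicator {0..2 * pi} \<theta> *\<^sub>R g 0 (0 + of_real 1 * cis \<theta>)) \<partial>lborel)"
      unfolding A_def by (intro nn_integral_cong) (simp add: indicator_def)
    ultimately show ?thesis by simp
  qed
  have "A \<longlonglongrightarrow> A'"
    unfolding A_def A'_def
  proof (rule nn_integral_dominated_convergence)
    show mA: "(\<lambda>\<theta>. e2ennreal (ereal (g k (0 + of_real 1 * cis \<theta>))) * indicator {0..2 * pi} \<theta>) \<in> borel_measurable lborel" for k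
      by measurable
    show "(\<lambda>\<theta>. e2ennreal (v (0 + of_real 1 * cis \<theta>)) * indicator {0..2 * pi} \<theta>) \<in> borel_measurable lborel"
      by (rule borel_measurable_LIMSEQ_order[OF limA mA])
    show "AE \<theta> in lborel. e2ennreal (ereal (g k (0 + of_real 1 * cis \<theta>))) * indicator {0..2 * pi} \<theta>
        \<le> e2ennreal (ereal (g 0 (0 + of_real 1 * cis \<theta>))) * indicator {0..2 * pi} \<theta>" for k
      by (intro AE_I2 mult_right_mono e2ennreal_mono) (use decs[of 0 k] in auto)
    show "(\<integral>\<^sup>+\<theta>\<in>{0..2 * pi}. e2ennreal (ereal (g 0 (0 + of_real 1 * cis \<theta>))) \<partial>lborel) < \<infinity>"
      using A0 by (simp add: A_def)
    show "(\<lambda>\<theta>. e2ennreal (ereal (g 0 (0 + of_real 1 * cis \<theta>))) * indicator {0..2 * pi} \<theta>) \<in> borel_measurable lborel"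
      by measurable
  qed (use limA in auto)
  moreover have "B \<longlonglongrightarrow> B'"
    unfolding B_def B'_def
  proof (rule nn_integral_LIMSEQ)
    show "incseq (\<lambda>k \<theta>. e2ennreal (- ereal (g k (0 + of_real 1 * cis \<theta>))) * indicator {0..2 * pi} \<theta>)"
      by (intro incseq_SucI le_funI mult_right_mono e2ennreal_mono) (use dec in auto)
    show "(\<lambda>\<theta>. e2ennreal (- ereal (g k (0 + of_real 1 * cis \<theta>))) * indicator {0..2 * pi} \<theta>) \<in> borel_measurable lborel" for k
      by measurable
  qed (use limB in auto)
  moreover have "A' < \<infinity>"
  proof -
    have "A k \<le> A 0" for k
      unfolding A_def by (intro nn_integral_mono mult_right_mono e2ennreal_mono) (use decs[of 0 k] in auto)
    then have "A' \<le> A 0" using \<open>A \<longlonglongrightarrow> A'\<close> by (intro LIMSEQ_le_const2) auto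
    then show ?thesis using A0 by (simp add: le_less_trans)
  qed
  ultimately have "(\<lambda>k. (enn2ereal (A k) - enn2ereal (B k)) / ereal (2 * pi)) \<longlonglongrightarrow> (enn2ereal A' - enn2ereal B') / ereal (2 * pi)"
    by (intro tendsto_divide_ereal tendsto_diff_ereal_general tendsto_enn2erealI tendsto_const)
       (auto elim!: ennreal_cases[of A'])
  then show ?thesis by (simp add: circle_mean_def A_def A'_def B_def B'_def)
qed

text \<open>This reduces a sub-mean value inequality to a comparison with real parts of entire
functions: the mean of \<open>v\<close> is the infimum of the values at the centre of its harmonic majorants.\<close>

lemma circle_mean_harmonic_majorant:
  assumes usc: "usc_on v (sphere 0 1)" and fin: "\<And>z. norm z = 1 \<Longrightarrow> v z < \<infinity>"
    and less: "circle_mean v 0 1 < ereal c"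
  obtains p where "p holomorphic_on UNIV" "\<And>z. norm z = 1 \<Longrightarrow> v z < ereal (Re (p z))" "Re (p 0) < c"
proof -
  obtain g :: "nat \<Rightarrow> complex \<Rightarrow> real" where cont: "\<And>k. continuous_on UNIV (g k)" and dec: "\<And>k x. g (Suc k) x \<le> g k x"
    and vg: "\<And>k x. x \<in> sphere 0 1 \<Longrightarrow> v x \<le> ereal (g k x)"
    and lim: "\<And>x. x \<in> sphere 0 1 \<Longrightarrow> (\<lambda>k. ereal (g k x)) \<longlonglongrightarrow> v x"
    using usc_decreasing_continuous_limit[OF usc] fin by (auto simp: sphere_eq_empty)
  have "\<forall>\<^sub>F k in sequentially. circle_mean (\<lambda>z. ereal (g k z)) 0 1 < ereal c"
    using order_tendstoD(2)[OF circle_mean_decreasing_limit[OF cont dec lim] less] .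
  then obtain k where k: "circle_mean (\<lambda>z. ereal (g k z)) 0 1 < ereal c"
    by (auto simp: eventually_sequentially)
  have cont': "continuous_on {0..2 * pi} (\<lambda>\<theta>. g k (0 + of_real 1 * cis \<theta>))"
    by (intro continuous_on_compose2[OF cont]) (auto intro!: continuous_intros)
  obtain I where I: "((\<lambda>\<theta>. g k (0 + of_real 1 * cis \<theta>)) has_integral I) {0..2 * pi}"
    using integrable_continuous_real[OF cont'] by (auto simp: integrable_on_def)
  have Ic: "I / (2 * pi) < c" using k circle_mean_continuous[OF I cont'] by simp
  \<comment> \<open>The polynomial \<open>q\<close> is to lie strictly between \<open>g k\<close> and \<open>g k + 2 * \<epsilon>\<close>, whose mean is still below \<open>c\<close>.\<close>
  define \<epsilon> where "\<epsilon> = (c - I / (2 * pi)) / 3"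
  have \<epsilon>: "\<epsilon> > 0" using Ic by (simp add: \<epsilon>_def)
  have "continuous_on (sphere 0 1) (\<lambda>x. g k x + \<epsilon>)"
    by (intro continuous_intros continuous_on_subset[OF cont]) auto
  from Stone_Weierstrass_real_polynomial_function[OF compact_sphere this \<epsilon>]
  obtain q where q: "real_polynomial_function q" "\<And>x. x \<in> sphere 0 1 \<Longrightarrow> \<bar>(g k x + \<epsilon>) - q x\<bar> < \<epsilon>"
    by blast
  obtain P where P: "\<And>s. P s holomorphic_on UNIV" "\<And>s z. norm z = 1 \<Longrightarrow> Re (P s z) = q (of_real s * z)"
    using real_polynomial_harmonic_extension[OF q(1)] by metis
  have 1: "((\<lambda>\<theta>. g k (0 + of_real 1 * cis \<theta>) + 2 * \<epsilon>) has_integral I + 2 * pi * (2 * \<epsilon>)) {0..2 * pi}"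
    using has_integral_add[OF I has_integral_const_real[of "2 * \<epsilon>" 0 "2*pi"]] by simp
  have "ereal (Re (P 1 0) + 0) = circle_mean (\<lambda>z. ereal (Re (P 1 z) + 0)) 0 1"
    by (rule circle_mean_Re_holomorphic[OF P(1) zero_less_one, symmetric])
  also have "\<dots> \<le> circle_mean (\<lambda>z. ereal (g k z + 2 * \<epsilon>)) 0 1"
  proof (rule circle_mean_mono)
    fix z :: complex assume "dist 0 z = \<bar>1\<bar>"
    then show "ereal (Re (P 1 z) + 0) \<le> ereal (g k z + 2 * \<epsilon>)" using q(2)[of z] P(2)[of z 1] by (simp add: abs_if split: if_splits)
  qed
  also have "\<dots> = ereal ((I + 2 * pi * (2 * \<epsilon>)) / (2 * pi))"
    using 1 by (rule circle_mean_continuous) (intro continuous_intros cont')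
  finally have "Re (P 1 0) \<le> I / (2 * pi) + 2 * \<epsilon>" by (simp add: add_divide_distrib)
  also have "\<dots> < c" using Ic by (simp add: \<epsilon>_def field_simps)
  finally have "Re (P 1 0) < c" .
  moreover have "v z < ereal (Re (P 1 z))" if "norm z = 1" for z
  proof -
    have "v z \<le> ereal (g k z)" using vg that by simp
    also have "\<dots> < ereal (Re (P 1 z))" using q(2)[of z] P(2)[of z 1] that by (simp add: abs_if split: if_splits)
    finally show ?thesis .
  qed
  ultimately show ?thesis using that P(1) by blast
qed

section \<open>Subharmonic functions of the real part\<close>

text \<open>A subharmonic function of the real part alone is convex, whence the bound by its values at the
ends.  Here is the direct argument: if a value exceeded both, $v(t)+\delta t^2$ would have an interior maximum on the
segment, and on a small circle $t^2$ differs from the harmonic $\frac12 \Re z^2$ by half the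
squared modulus, a contradiction to the sub-mean value inequality.\<close>

lemma Re_invariant_subharmonic_quasiconvex:
  assumes sub: "subharmonic_on v S"
    and strip: "\<And>s. 0 \<le> s \<Longrightarrow> s \<le> 1 \<Longrightarrow> of_real s \<in> S"
    and inv: "\<And>z. z \<in> S \<Longrightarrow> v z = v (of_real (Re z))"
    and ends: "v 0 < ereal c" "v 1 < ereal c" and s: "0 \<le> s" "s \<le> 1"
  shows "v (of_real s) < ereal c"
proof -
  have usc: "usc_on v S" and fin: "\<And>z. z \<in> S \<Longrightarrow> v z < \<infinity>" and openS: "open S"
    using sub by (auto simp: subharmonic_on_def)
  obtain c0 where c0: "v 0 \<le> ereal c0" "v 1 \<le> ereal c0" "c0 < c"
  proof -
    have "max (v 0) (v 1) < ereal c" using ends by simp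
    then obtain k where "max (v 0) (v 1) < ereal k" "ereal k < ereal c" using ereal_dense2 by blast
    then show ?thesis by (intro that[of k]) auto
  qed
  have "v (of_real s) \<le> ereal c0"
  proof (rule ccontr)
    assume "\<not> ?thesis"
    then obtain e where e: "ereal c0 < ereal e" "ereal e < v (of_real s)" using ereal_dense2[of "ereal c0" "v (of_real s)"] by (auto simp: not_le)
    define \<delta> where "\<delta> = e - c0"
    have \<delta>: "\<delta> > 0" using e by (simp add: \<delta>_def)
    have "continuous_on {0..1} complex_of_real" by (intro continuous_intros)
    then have "usc_on (\<lambda>t. v (of_real t)) {0..1::real}"
      using strip by (intro usc_on_compose[OF usc]) auto
    then have "usc_on (\<lambda>t. v (of_real t) + ereal (\<delta> * t\<^sup>2)) {0..1::real}"
      by (intro usc_on_add_continuous continuous_intros)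
    from usc_attains_sup[OF compact_Icc _ this] obtain t where t: "t \<in> {0..1}"
      and max: "\<And>y. y \<in> {0..1} \<Longrightarrow> v (of_real y) + ereal (\<delta> * y\<^sup>2) \<le> v (of_real t) + ereal (\<delta> * t\<^sup>2)"
      by auto
    have tS: "of_real t \<in> S" using t strip by auto
    have "ereal e < v (of_real t) + ereal (\<delta> * t\<^sup>2)"
    proof -
      have "ereal e < v (of_real s) + ereal (\<delta> * s\<^sup>2)"
      proof (cases "v (of_real s)")
        case (real x)
        moreover have "0 \<le> \<delta> * s\<^sup>2" using \<delta> by simp
        ultimately have "e < x + \<delta> * s\<^sup>2" using e(2) by simp
        then show ?thesis using real by simp
      qed (use e in auto)
      also have "\<dots> \<le> v (of_real t) + ereal (\<delta> * t\<^sup>2)" using s by (intro max) auto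
      finally show ?thesis .
    qed
    then obtain V where V: "v (of_real t) = ereal V" "e < V + \<delta> * t\<^sup>2"
      using fin[OF tS] by (cases "v (of_real t)") auto
    have "t \<noteq> 0" using V c0 e by auto
    moreover have "t \<noteq> 1" using V c0 by (auto simp: \<delta>_def)
    ultimately have t01: "0 < t" "t < 1" using t by auto
    obtain r0 where r0: "r0 > 0" "ball (of_real t) r0 \<subseteq> S" using openS tS by (auto simp: open_contains_ball)
    define r where "r = min (r0/2) (min t (1-t))"
    have r: "r > 0" "cball (of_real t) r \<subseteq> S" "r \<le> t" "r \<le> 1 - t" using r0 t01 by (auto simp: r_def subset_iff)
    define f where "f z = - of_real (2 * \<delta> * t) * (z - of_real t) - of_real (\<delta> / 2) * (z - of_real t)\<^sup>2" for z :: complex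
    have "v (of_real t) \<le> ereal (Re (f (of_real t)) + (V - \<delta> / 2 * r\<^sup>2))"
    proof (rule subharmonic_le_harmonic_bound[OF sub r(1,2)])
      show "f holomorphic_on UNIV" unfolding f_def by (intro holomorphic_intros)
      fix z :: complex assume z: "dist (of_real t) z = r"
      define x y where "x = Re z - t" and "y = Im z"
      have zt: "z - of_real t = Complex x y" by (simp add: x_def y_def complex_eq_iff)
      have xy: "x\<^sup>2 + y\<^sup>2 = r\<^sup>2" 
      proof -
        have "norm (Complex x y) = r" using z by (simp add: zt[symmetric] dist_norm norm_minus_commute)
        then show ?thesis using cmod_power2[of "Complex x y"] by simp
      qed
      have "x\<^sup>2 \<le> r\<^sup>2" using xy zero_le_power2[of y] by linarith
      then have "\<bar>x\<bar> \<le> r" using abs_le_square_iff[of x r] r(1) by simp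
      then have rz: "Re z \<in> {0..1}" using r by (auto simp: x_def abs_le_iff)
      have "z \<in> S" using z r(2) by auto
      have "v (of_real (Re z)) + ereal (\<delta> * (Re z)\<^sup>2) \<le> ereal (V + \<delta> * t\<^sup>2)" using max[OF rz] V by simp
      then have "v (of_real (Re z)) \<le> ereal (V + \<delta> * t\<^sup>2 - \<delta> * (Re z)\<^sup>2)" by (cases "v (of_real (Re z))") auto
      also have "V + \<delta> * t\<^sup>2 - \<delta> * (Re z)\<^sup>2 = V - 2 * \<delta> * t * x - \<delta> * x\<^sup>2"
        by (simp add: x_def algebra_simps power2_eq_square)
      also have "\<dots> = Re (f z) + (V - \<delta> / 2 * r\<^sup>2)"
        unfolding f_def zt xy[symmetric] by (simp add: power2_eq_square field_simps)
      finally show "v z \<le> ereal (Re (f z) + (V - \<delta> / 2 * r\<^sup>2))" using inv[OF \<open>z \<in> S\<close>] by simp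
    qed
    then show False
      using mult_pos_pos[OF \<delta> zero_less_power[OF r(1), of 2]] V(1) by (simp add: f_def)
  qed
  also have "ereal c0 < ereal c" using c0 by simp
  finally show ?thesis .
qed

section \<open>Analytic discs in pseudoconvex tube domains\<close>

definition cvec :: "real ^ 'n \<Rightarrow> complex ^ 'n" where
  "cvec x = (\<chi> i. of_real (x $ i))"

definition revec :: "complex ^ 'n \<Rightarrow> real ^ 'n" where
  "revec z = (\<chi> i. Re (z $ i))"

lemma revec_cvec [simp]: "revec (cvec x) = x"
  by (simp add: revec_def cvec_def)

lemma continuous_on_cvec [continuous_intros]:
  "continuous_on S f \<Longrightarrow> continuous_on S (\<lambda>x. cvec (f x))"
  unfolding cvec_def by (intro continuous_intros)

definition tube_fibers :: "('a \<times> (complex ^ 'n)) set \<Rightarrow> bool" where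
  "tube_fibers \<Omega> \<longleftrightarrow> (\<forall>t z z'. (t, z) \<in> \<Omega> \<longrightarrow> revec z' = revec z \<longrightarrow> (t, z') \<in> \<Omega>)"

lemma tube_fibers_iff: "tube_fibers \<Omega> \<Longrightarrow> (t, z) \<in> \<Omega> \<longleftrightarrow> (t, cvec (revec z)) \<in> \<Omega>"
  unfolding tube_fibers_def by (metis revec_cvec)

lemma polynomial_harmonic_extension:
  fixes q :: "complex \<Rightarrow> real ^ 'n"
  assumes "polynomial_function q"
  obtains P :: "real \<Rightarrow> complex \<Rightarrow> complex ^ 'n"
  where "continuous_on UNIV (\<lambda>x. P (fst x) (snd x))" "\<And>s i. (\<lambda>z. P s z $ i) holomorphic_on UNIV"
    "\<And>s z. norm z = 1 \<Longrightarrow> revec (P s z) = q (of_real s * z)" "\<And>z. revec (P 0 z) = q 0"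
proof -
  have "\<exists>P :: real \<Rightarrow> complex \<Rightarrow> complex. continuous_on UNIV (\<lambda>x. P (fst x) (snd x)) \<and> (\<forall>s. P s holomorphic_on UNIV) \<and>
     (\<forall>s z. norm z = 1 \<longrightarrow> Re (P s z) = q (of_real s * z) $ i) \<and> (\<forall>z. Re (P 0 z) = q 0 $ i)" for i
  proof -
    have "real_polynomial_function ((\<lambda>x. x $ i) \<circ> q)"
      using assms bounded_linear_vec_nth[of i] by (auto simp: polynomial_function_def)
    then have "real_polynomial_function (\<lambda>z. q z $ i)" by (simp add: o_def)
    from real_polynomial_harmonic_extension[OF this] show ?thesis by metis
  qed
  then obtain P :: "'n \<Rightarrow> real \<Rightarrow> complex \<Rightarrow> complex" where
    P: "\<And>i. continuous_on UNIV (\<lambda>x. P i (fst x) (snd x))" "\<And>i s. P i s holomorphic_on UNIV"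
     "\<And>i s z. norm z = 1 \<Longrightarrow> Re (P i s z) = q (of_real s * z) $ i" "\<And>i z. Re (P i 0 z) = q 0 $ i"
    by metis
  show ?thesis
    by (rule that[of "\<lambda>s z. \<chi> i. P i s z"])
      (use P in \<open>auto simp: revec_def vec_eq_iff intro!: continuous_on_vec_lambda\<close>)
qed

text \<open>The continuity principle (Kontinuitaetssatz).  Let \<open>q\<close> be a section over the closed unit disc,
and let the \<open>s\<close>-th disc be the harmonic extension of \<open>q\<close> restricted to the circle of radius
\<open>s\<close>, with some conjugate function as imaginary part.  All boundaries of these discs lie in one
compact subset of \<open>\<Omega>\<close>, where the exhaustion \<open>\<rho>\<close> is at most some \<open>C\<close>; by the maximum principle,
a disc contained in \<open>\<Omega>\<close> is contained in the compact set where \<open>\<rho>\<close> is at most \<open>C\<close>.  Hence the set of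
parameters whose disc lies in \<open>\<Omega>\<close> is closed, it is open since the discs are compact, and it
contains \<open>0\<close>, where the disc has constant real part.\<close>

lemma analytic_discs_stay_in_domain:
  fixes \<Omega> :: "((complex ^ 'r) \<times> (complex ^ 'n)) set"
  assumes pc: "pseudoconvex_domain \<Omega>" and tube: "tube_fibers \<Omega>"
    and contP: "continuous_on UNIV (\<lambda>x. P (fst x) (snd x))" and holP: "\<And>s i. (\<lambda>z. P s z $ i) holomorphic_on UNIV"
    and bdP: "\<And>s z. norm z = 1 \<Longrightarrow> revec (P s z) = q (of_real s * z)" and P0: "\<And>z. revec (P 0 z) = q 0"
    and sec: "\<And>z. norm z \<le> 1 \<Longrightarrow> (a + z *\<^sub>C w, cvec (q z)) \<in> \<Omega>"
    and s: "0 \<le> s" "s \<le> 1" and z: "norm z \<le> 1"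
  shows "(a + (of_real s * z) *\<^sub>C w, P s z) \<in> \<Omega>"
proof -
  obtain \<rho> where open\<Omega>: "open \<Omega>" and psh: "plurisubharmonic_on (\<lambda>x. ereal (\<rho> x)) \<Omega>"
    and cont\<rho>: "continuous_on \<Omega> \<rho>" and exh: "\<And>c. compact {x \<in> \<Omega>. \<rho> x \<le> c}"
    using pc by (auto simp: pseudoconvex_domain_def)
  define F where "F x = (a + (of_real (fst x) * snd x) *\<^sub>C w, P (fst x) (snd x))" for x :: "real \<times> complex"
  have contF: "continuous_on S F" for S
    unfolding F_def
    by (intro continuous_intros continuous_on_subset[OF contP]) auto
  define B where "B = F ` ({0..1} \<times> sphere 0 1)"
  have bd: "F (s, z) \<in> \<Omega>" if "0 \<le> s" "s \<le> 1" "norm z = 1" for s z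
  proof -
    have "(a + (of_real s * z) *\<^sub>C w, cvec (q (of_real s * z))) \<in> \<Omega>"
      using that by (intro sec) (simp add: norm_mult)
    then show ?thesis
      using tube_fibers_iff[OF tube, of "a + (of_real s * z) *\<^sub>C w" "P s z"] bdP[OF that(3)] by (simp add: F_def)
  qed
  have "compact B" unfolding B_def by (intro compact_continuous_image contF compact_Times) auto
  moreover have B\<Omega>: "B \<subseteq> \<Omega>" using bd by (auto simp: B_def)
  ultimately have "compact (\<rho> ` B)" by (intro compact_continuous_image continuous_on_subset[OF cont\<rho>])
  from bounded_imp_bdd_above[OF compact_imp_bounded[OF this]]
  obtain C where C: "\<And>x. x \<in> B \<Longrightarrow> \<rho> x \<le> C" by (auto simp: bdd_above_def)
  define L where "L = {x \<in> \<Omega>. \<rho> x \<le> C}"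
  have L: "compact L" unfolding L_def by (rule exh)
  define S where "S = {s \<in> {0..1}. \<forall>z\<in>cball 0 1. F (s, z) \<in> \<Omega>}"
  have SL: "F (s, z) \<in> L" if "s \<in> S" "norm z \<le> 1" for s z
  proof -
    have eq: "F (s, z) = (a + z *\<^sub>C (of_real s *\<^sub>C w), P s z)" for z
      by (simp add: F_def scaleC_scaleC mult.commute)
    have "ereal (\<rho> (a + z *\<^sub>C (of_real s *\<^sub>C w), P s z)) \<le> ereal (Re (of_real C))"
    proof (rule psh_disc_max_principle[OF psh holP])
      show "(\<lambda>z. of_real C) holomorphic_on UNIV" by (intro holomorphic_intros)
      show "(a + z *\<^sub>C (of_real s *\<^sub>C w), P s z) \<in> \<Omega>" if "norm z \<le> 1" for z
        using \<open>s \<in> S\<close> that unfolding eq[symmetric] by (simp add: S_def)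
      show "ereal (\<rho> (a + z *\<^sub>C (of_real s *\<^sub>C w), P s z)) \<le> ereal (Re (of_real C))" if "norm z = 1" for z
      proof -
        have "F (s, z) \<in> B" using \<open>s \<in> S\<close> that by (auto simp: B_def S_def)
        then show ?thesis using C unfolding eq[symmetric] by simp
      qed
    qed fact
    then show ?thesis using that unfolding eq[symmetric] by (simp add: S_def L_def)
  qed
  have "closed S"
  proof -
    have "S = {0..1} \<inter> (\<Inter>z\<in>cball 0 1. (\<lambda>s. F (s, z)) -` L)"
      using SL by (auto simp: S_def L_def)
    moreover have "continuous_on UNIV (\<lambda>s. F (s, z))" for z
      by (intro continuous_on_compose2[OF contF[of UNIV]]) (auto intro!: continuous_intros)
    ultimately show ?thesis
      using compact_imp_closed[OF L] by (auto intro!: closed_vimage)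
  qed
  define T where "T = fst ` (({0..1} \<times> cball 0 1) \<inter> F -` (- \<Omega>))"
  have "closed T"
  proof -
    have "compact (({0..1} \<times> cball 0 1) \<inter> F -` (- \<Omega>))"
      using open\<Omega> contF by (intro compact_Int_closed compact_Times closed_vimage) auto
    then have "compact T" unfolding T_def by (intro compact_continuous_image continuous_intros)
    then show ?thesis by (rule compact_imp_closed)
  qed
  have ST: "S \<union> T = {0..1}" "S \<inter> T = {}" by (force simp: S_def T_def)+
  have "0 \<in> S"
  proof -
    have "F (0, z) \<in> \<Omega>" for z
      using sec[of 0] P0[of z] tube_fibers_iff[OF tube, of "a + 0 *\<^sub>C w" "P 0 z"] by (simp add: F_def)
    then show ?thesis by (simp add: S_def)
  qed
  have "T = {}"
    using connected_closedD[OF connected_Icc[of "0::real" 1] _ _ \<open>closed S\<close> \<open>closed T\<close>] ST \<open>0 \<in> S\<close> by auto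
  then have "s \<in> S" using s ST by auto
  then show ?thesis using z by (auto simp: S_def F_def)
qed

section \<open>Convexity of the fibres\<close>

text \<open>For a half plane cutting out an arc of length $2\pi v$, the loop runs through the path
\<open>\<gamma>\<close> near the ends of the arc and rests at \<open>\<gamma> 1\<close> on the arc and at \<open>\<gamma> 0\<close> off it.  The faster the
transition, the closer the mean comes to the convex combination of the two ends.  The
half plane is $\Re(z e^{-i\pi v}) > \cos(\pi v)$, which makes the loop the restriction of a map
that is continuous on the whole plane.\<close>

lemma threshold_loop_mean:
  fixes \<gamma> :: "real \<Rightarrow> 'a::euclidean_space"
  assumes cont: "continuous_on {0..1} \<gamma>" and v: "0 \<le> v" "v \<le> 1" and \<epsilon>: "0 < \<epsilon>"
  obtains X :: "complex \<Rightarrow> 'a" where "continuous_on UNIV X" "range X \<subseteq> \<gamma> ` {0..1}"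
    "norm (integral {0..2 * pi} (\<lambda>\<theta>. X (cis \<theta>)) - (2 * pi) *\<^sub>R ((1 - v) *\<^sub>R \<gamma> 0 + v *\<^sub>R \<gamma> 1)) < \<epsilon>"
proof -
  \<comment> \<open>Clamping keeps the parameter of the path in its domain.\<close>
  define c where "c s = max 0 (min 1 s)" for s :: real
  have cI: "c s \<in> {0..1}" for s by (auto simp: c_def)
  define X where "X k z = \<gamma> (c (1/2 + real k * (Re (z * cis (- pi * v)) - cos (pi * v))))" for k z
  have contX: "continuous_on S (X k)" for k S
    unfolding X_def
    by (intro continuous_on_compose2[OF cont]) (use cI in \<open>auto simp: c_def intro!: continuous_intros\<close>)
  have rX: "X k z \<in> \<gamma> ` {0..1}" for k z unfolding X_def using cI by (intro imageI)
  have Xcis: "X k (cis \<theta>) = \<gamma> (c (1/2 + real k * (cos (\<theta> - pi * v) - cos (pi * v))))" for k \<theta>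
    by (simp add: X_def cis_mult)
  \<comment> \<open>On the three exceptional angles the threshold is attained exactly, for every steepness \<open>k\<close>.\<close>
  define f where "f \<theta> = (if \<theta> \<in> {0, 2 * pi * v, 2 * pi} then \<gamma> (1/2) else if \<theta> < 2 * pi * v then \<gamma> 1 else \<gamma> 0)" for \<theta>
  have lim: "(\<lambda>k. X k (cis \<theta>)) \<longlonglongrightarrow> f \<theta>" if \<theta>: "\<theta> \<in> {0..2 * pi}" for \<theta>
  proof -
    consider "\<theta> \<in> {0, 2 * pi * v, 2 * pi}" | "0 < \<theta>" "\<theta> < 2 * pi * v" | "\<theta> > 2 * pi * v" "\<theta> < 2 * pi"
      using \<theta> by force
    then show ?thesis
    proof cases
      case 1
      have "cos (\<theta> - pi * v) = cos (pi * v)"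
      proof -
        have "\<theta> - pi * v = - (pi * v) \<or> \<theta> - pi * v = pi * v \<or> \<theta> - pi * v = 2 * pi - pi * v" using 1 by auto
        moreover have "cos (2 * pi - pi * v) = cos (pi * v)" by (simp add: cos_diff)
        ultimately show ?thesis by auto
      qed
      then show ?thesis using 1 by (simp add: Xcis f_def c_def)
    next
      case 2
      have "pi * v \<le> pi" using v by simp
      have "cos (pi * v) < cos \<bar>\<theta> - pi * v\<bar>"
        by (rule cos_monotone_0_pi) (use 2 \<open>pi * v \<le> pi\<close> in auto)
      then have d: "cos (\<theta> - pi * v) - cos (pi * v) > 0" by (simp add: cos_abs_real)
      have "\<forall>\<^sub>F k in sequentially. real k \<ge> 1 / (cos (\<theta> - pi * v) - cos (pi * v))"
        by (rule filterlim_real_sequentially[THEN filterlim_at_top[THEN iffD1], rule_format])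
      then have "\<forall>\<^sub>F k in sequentially. X k (cis \<theta>) = f \<theta>"
      proof eventually_elim
        case (elim k)
        then have "real k * (cos (\<theta> - pi * v) - cos (pi * v)) \<ge> 1" using d by (simp add: field_simps)
        moreover have "\<theta> \<noteq> 2 * pi" using 2 \<open>pi * v \<le> pi\<close> by linarith
        ultimately show ?case using 2 by (simp add: Xcis f_def c_def)
      qed
      then show ?thesis by (rule tendsto_eventually)
    next
      case 3
      have "0 \<le> pi * v" using v by simp
      have "cos (pi * v) > cos (\<theta> - pi * v)"
      proof (cases "\<theta> - pi * v \<le> pi")
        case True
        then show ?thesis by (intro cos_monotone_0_pi) (use 3 \<open>0 \<le> pi * v\<close> in auto)
      next
        case False
        have "cos (\<theta> - pi * v) = cos (2 * pi - (\<theta> - pi * v))" by (simp add: cos_diff)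
        also have "\<dots> < cos (pi * v)"
          by (intro cos_monotone_0_pi) (use 3 False \<open>0 \<le> pi * v\<close> in auto)
        finally show ?thesis .
      qed
      then have d: "cos (pi * v) - cos (\<theta> - pi * v) > 0" by simp
      have "\<forall>\<^sub>F k in sequentially. real k \<ge> 1 / (cos (pi * v) - cos (\<theta> - pi * v))"
        by (rule filterlim_real_sequentially[THEN filterlim_at_top[THEN iffD1], rule_format])
      then have "\<forall>\<^sub>F k in sequentially. X k (cis \<theta>) = f \<theta>"
      proof eventually_elim
        case (elim k)
        then have "real k * (cos (pi * v) - cos (\<theta> - pi * v)) \<ge> 1" using d by (simp add: field_simps)
        then have "real k * (cos (\<theta> - pi * v) - cos (pi * v)) \<le> - 1" by (simp add: algebra_simps)
        moreover have "\<theta> \<noteq> 0" using 3 \<open>0 \<le> pi * v\<close> by linarith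
        ultimately show ?case using 3 by (simp add: Xcis f_def c_def)
      qed
      then show ?thesis by (rule tendsto_eventually)
    qed
  qed
  have "bounded (\<gamma> ` {0..1})"
    by (intro compact_imp_bounded compact_continuous_image cont) auto
  then obtain B where B: "\<And>x. x \<in> \<gamma> ` {0..1} \<Longrightarrow> norm x \<le> B" unfolding bounded_iff by blast
  have "(\<lambda>k. integral {0..2 * pi} (\<lambda>\<theta>. X k (cis \<theta>))) \<longlonglongrightarrow> integral {0..2 * pi} f"
  proof (rule dominated_convergence(2))
    show "(\<lambda>\<theta>. X k (cis \<theta>)) integrable_on {0..2 * pi}" for k
      by (intro integrable_continuous_real continuous_on_compose2[OF contX[of UNIV]]) (auto intro!: continuous_intros)
    show "(\<lambda>_. B) integrable_on {0..2 * pi}" by (rule integrable_const_ivl)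
    show "norm (X k (cis \<theta>)) \<le> B" if "\<theta> \<in> {0..2 * pi}" for k \<theta> using B rX by blast
  qed (rule lim)
  also have "integral {0..2 * pi} f = (2 * pi) *\<^sub>R ((1 - v) *\<^sub>R \<gamma> 0 + v *\<^sub>R \<gamma> 1)"
  proof (rule integral_unique)
    have v': "0 \<le> 2 * pi * v" "2 * pi * v \<le> 2 * pi" using v by auto
    have 1: "(f has_integral (2 * pi * v - 0) *\<^sub>R \<gamma> 1) {0..2 * pi * v}"
      by (rule has_integral_spike_finite[OF _ _ has_integral_const_real[of "\<gamma> 1" 0 "2 * pi * v", simplified content_real[OF v'(1)]],
            of "{0, 2 * pi * v, 2 * pi}"]) (auto simp: f_def)
    have 2: "(f has_integral (2 * pi - 2 * pi * v) *\<^sub>R \<gamma> 0) {2 * pi * v..2 * pi}"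
      by (rule has_integral_spike_finite[OF _ _ has_integral_const_real[of "\<gamma> 0" "2 * pi * v" "2 * pi", simplified content_real[OF v'(2)]],
            of "{0, 2 * pi * v, 2 * pi}"]) (auto simp: f_def)
    from has_integral_combine[OF v' 1 2]
    show "(f has_integral (2 * pi) *\<^sub>R ((1 - v) *\<^sub>R \<gamma> 0 + v *\<^sub>R \<gamma> 1)) {0..2 * pi}"
      by (simp add: algebra_simps)
  qed
  finally have "\<forall>\<^sub>F k in sequentially. dist (integral {0..2 * pi} (\<lambda>\<theta>. X k (cis \<theta>)))
      ((2 * pi) *\<^sub>R ((1 - v) *\<^sub>R \<gamma> 0 + v *\<^sub>R \<gamma> 1)) < \<epsilon>"
    using \<epsilon> by (rule tendstoD)
  then obtain k where "dist (integral {0..2 * pi} (\<lambda>\<theta>. X k (cis \<theta>))) ((2 * pi) *\<^sub>R ((1 - v) *\<^sub>R \<gamma> 0 + v *\<^sub>R \<gamma> 1)) < \<epsilon>"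
    by (auto simp: eventually_sequentially)
  moreover have "range (X k) \<subseteq> \<gamma> ` {0..1}" using rX by blast
  ultimately show ?thesis using that[of "X k"] contX by (auto simp: dist_norm)
qed

lemma harmonic_extension_centre:
  fixes P :: "complex \<Rightarrow> complex ^ 'n"
  assumes holP: "\<And>i. (\<lambda>z. P z $ i) holomorphic_on UNIV" and bd: "\<And>z. norm z = 1 \<Longrightarrow> revec (P z) = q z"
    and q: "((\<lambda>\<theta>. q (cis \<theta>)) has_integral (2 * pi) *\<^sub>R m) {0..2 * pi}"
  shows "revec (P 0) = m"
  unfolding vec_eq_iff
proof
  fix i
  have A: "((\<lambda>\<theta>. Re (P (0 + of_real 1 * cis \<theta>) $ i)) has_integral 2 * pi * Re (P 0 $ i)) {0..2 * pi}"
    using has_integral_linear[OF holomorphic_mean_value[OF holP[of i], of 1 0] bounded_linear_Re] by (simp add: o_def)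
  have eq: "Re (P (0 + of_real 1 * cis \<theta>) $ i) = q (cis \<theta>) $ i" for \<theta>
    using bd[of "cis \<theta>"] by (simp add: revec_def vec_eq_iff)
  have B: "((\<lambda>\<theta>. q (cis \<theta>) $ i) has_integral 2 * pi * m $ i) {0..2 * pi}"
    using has_integral_linear[OF q bounded_linear_vec_nth[of i]] by (simp add: o_def)
  have "2 * pi * Re (P 0 $ i) = 2 * pi * m $ i" by (rule has_integral_unique[OF A[unfolded eq] B])
  then show "revec (P 0) $ i = m $ i" by (simp add: revec_def)
qed

text \<open>Bochner's tube theorem for pseudoconvex tubes, by analytic discs.  Join \<open>x\<close> and \<open>y\<close> by a path in
the base, and take a loop along this path whose mean is close to a given convex combination
\<open>m\<close>.  After a polynomial approximation and a small translation, the mean is exactly \<open>m\<close>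
and the values of the approximation over the closed disc are still in the base.  Its harmonic
extension is the real part of a disc that stays in the domain, and passes through \<open>m\<close> at the centre.\<close>

lemma tube_fiber_convex:
  fixes \<Omega> :: "((complex ^ 'r) \<times> (complex ^ 'n)) set"
  assumes pc: "pseudoconvex_domain \<Omega>" and tube: "tube_fibers \<Omega>"
    and conn: "connected {x. (t, cvec x) \<in> \<Omega>}"
  shows "convex {x. (t, cvec x) \<in> \<Omega>}"
proof -
  define \<omega> where "\<omega> = {x. (t, cvec x) \<in> \<Omega>}"
  have "open ((\<lambda>x. (t, cvec x)) -` \<Omega>)"
    using pc by (intro open_vimage continuous_intros) (auto simp: pseudoconvex_domain_def)
  then have open\<omega>: "open \<omega>" by (simp add: \<omega>_def vimage_def)
  have "(1 - v) *\<^sub>R x + v *\<^sub>R y \<in> \<omega>" if x: "x \<in> \<omega>" and y: "y \<in> \<omega>" and v: "0 \<le> v" "v \<le> 1" for x y v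
  proof -
    define m where "m = (1 - v) *\<^sub>R x + v *\<^sub>R y"
    have "path_connected \<omega>"
      using connected_open_path_connected[OF open\<omega>] conn by (simp add: \<omega>_def)
    then obtain \<gamma> where \<gamma>: "path \<gamma>" "path_image \<gamma> \<subseteq> \<omega>" "\<gamma> 0 = x" "\<gamma> 1 = y"
      using x y unfolding path_connected_def pathstart_def pathfinish_def by blast
    obtain e where e: "e > 0" "(\<Union>x\<in>path_image \<gamma>. cball x e) \<subseteq> \<omega>"
      using compact_subset_open_imp_cball_epsilon_subset[OF compact_path_image[OF \<gamma>(1)] open\<omega> \<gamma>(2)] by metis
    have e': "0 < 2 * pi * (e / 3)" using e by simp
    obtain X :: "complex \<Rightarrow> real ^ 'n" where X: "continuous_on UNIV X" "range X \<subseteq> path_image \<gamma>"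
      "norm (integral {0..2 * pi} (\<lambda>\<theta>. X (cis \<theta>)) - (2 * pi) *\<^sub>R m) < 2 * pi * (e / 3)"
      using threshold_loop_mean[OF \<gamma>(1)[unfolded path_def] v e'] unfolding \<gamma> m_def path_image_def by blast
    have e3: "0 < e / 3" using e by simp
    obtain g where g: "polynomial_function g" "\<And>z. z \<in> cball 0 1 \<Longrightarrow> norm (X z - g z) < e / 3"
      using Stone_Weierstrass_polynomial_function[OF compact_cball continuous_on_subset[OF X(1)] e3, of "0::complex" 1] by auto
    have contX: "continuous_on {0..2 * pi} (\<lambda>\<theta>. X (cis \<theta>))"
      by (intro continuous_on_compose2[OF X(1)]) (auto intro!: continuous_intros)
    have contg: "continuous_on {0..2 * pi} (\<lambda>\<theta>. g (cis \<theta>))"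
      by (intro continuous_on_compose2[OF continuous_on_polymonial_function[OF g(1), of UNIV]]) (auto intro!: continuous_intros)
    define m1 where "m1 = (1 / (2 * pi)) *\<^sub>R integral {0..2 * pi} (\<lambda>\<theta>. g (cis \<theta>))"
    have bound: "norm (integral {0..2 * pi} (\<lambda>\<theta>. g (cis \<theta>) - X (cis \<theta>))) \<le> e / 3 * (2 * pi - 0)"
      using g(2) by (intro integral_bound continuous_on_diff contX contg)
        (auto simp: norm_minus_commute intro!: less_imp_le)
    have diff: "integral {0..2 * pi} (\<lambda>\<theta>. g (cis \<theta>) - X (cis \<theta>))
        = integral {0..2 * pi} (\<lambda>\<theta>. g (cis \<theta>)) - integral {0..2 * pi} (\<lambda>\<theta>. X (cis \<theta>))"
      by (intro integral_diff integrable_continuous_real contX contg)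
    have "norm ((integral {0..2 * pi} (\<lambda>\<theta>. g (cis \<theta>)) - integral {0..2 * pi} (\<lambda>\<theta>. X (cis \<theta>)))
       + (integral {0..2 * pi} (\<lambda>\<theta>. X (cis \<theta>)) - (2 * pi) *\<^sub>R m)) \<le> 2 * pi * (e / 3) + 2 * pi * (e / 3)"
      using bound[unfolded diff] X(3) by (intro norm_triangle_le add_mono) (auto simp: mult.commute)
    then have "norm (integral {0..2 * pi} (\<lambda>\<theta>. g (cis \<theta>)) - (2 * pi) *\<^sub>R m) \<le> 2 * pi * (2 * e / 3)"
      by (simp add: field_simps)
    moreover have "integral {0..2 * pi} (\<lambda>\<theta>. g (cis \<theta>)) - (2 * pi) *\<^sub>R m = (2 * pi) *\<^sub>R (m1 - m)"
      by (simp add: m1_def scaleR_diff_right)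
    ultimately have m1: "norm (m1 - m) \<le> 2 * e / 3" by simp
    \<comment> \<open>The translation that moves the mean of the boundary values to \<open>m\<close>.\<close>
    define q where "q z = g z - (m1 - m)" for z
    have "polynomial_function q"
      unfolding q_def using g(1) by (intro polynomial_function_diff polynomial_function_const)
    then obtain P :: "real \<Rightarrow> complex \<Rightarrow> complex ^ 'n"
      where P: "continuous_on UNIV (\<lambda>x. P (fst x) (snd x))" "\<And>s i. (\<lambda>z. P s z $ i) holomorphic_on UNIV"
        "\<And>s z. norm z = 1 \<Longrightarrow> revec (P s z) = q (of_real s * z)" "\<And>z. revec (P 0 z) = q 0"
      using polynomial_harmonic_extension by blast
    have q\<omega>: "q z \<in> \<omega>" if "norm z \<le> 1" for z
    proof -
      have "norm (X z - q z) \<le> norm (X z - g z) + norm (m1 - m)"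
        using norm_triangle_ineq[of "X z - g z" "m1 - m"] by (simp add: q_def algebra_simps)
      also have "\<dots> \<le> e" using g(2)[of z] m1 that by simp
      finally have "q z \<in> cball (X z) e" by (simp add: dist_norm)
      then show ?thesis using e X(2) by blast
    qed
    have z0: "c *\<^sub>C 0 = (0 :: complex ^ 'r)" for c by (simp add: vec_eq_iff scaleC_vec_component)
    have "(t + (of_real 1 * 0) *\<^sub>C 0, P 1 0) \<in> \<Omega>"
    proof (rule analytic_discs_stay_in_domain[OF pc tube P])
      show "(t + z *\<^sub>C 0, cvec (q z)) \<in> \<Omega>" if "norm z \<le> 1" for z
        using q\<omega>[OF that] by (simp add: \<omega>_def z0)
    qed auto
    moreover have "revec (P 1 0) = m"
    proof (rule harmonic_extension_centre[OF P(2)])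
      show "revec (P 1 z) = q z" if "norm z = 1" for z using P(3)[OF that, of 1] by simp
      have "((\<lambda>\<theta>. g (cis \<theta>)) has_integral (2 * pi) *\<^sub>R m1) {0..2 * pi}"
        using integrable_integral[OF integrable_continuous_real[OF contg]] by (simp add: m1_def)
      from has_integral_diff[OF this has_integral_const_real[of "m1 - m" 0 "2 * pi"]]
      show "((\<lambda>\<theta>. q (cis \<theta>)) has_integral (2 * pi) *\<^sub>R m) {0..2 * pi}"
        by (simp add: q_def scaleR_diff_right)
    qed
    ultimately show ?thesis
      using tube_fibers_iff[OF tube, of t "P 1 0"] by (simp add: \<omega>_def m_def z0)
  qed
  then have "convex \<omega>" unfolding convex_alt by blast
  then show ?thesis by (simp add: \<omega>_def)
qed

section \<open>Sections with prescribed bounds\<close>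

lemma connected_tube_domainD:
  fixes T :: "(complex ^ 'n) set"
  assumes "connected_tube_domain T"
  shows "connected {x. cvec x \<in> T}" and "z \<in> T \<Longrightarrow> revec z' = revec z \<Longrightarrow> z' \<in> T"
proof -
  obtain \<omega> :: "(real ^ 'n) set" where \<omega>: "connected \<omega>" "T = {(\<chi> i. Complex (x $ i) (y $ i)) | x y. x \<in> \<omega>}"
    using assms by (auto simp: connected_tube_domain_def)
  have T: "z \<in> T \<longleftrightarrow> revec z \<in> \<omega>" for z
  proof
    assume "z \<in> T"
    then obtain x y where "x \<in> \<omega>" "z = (\<chi> i. Complex (x $ i) (y $ i))" using \<omega> by auto
    then show "revec z \<in> \<omega>" by (simp add: revec_def)
  next
    assume "revec z \<in> \<omega>"
    moreover have "z = (\<chi> i. Complex (revec z $ i) ((\<chi> i. Im (z $ i)) $ i))"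
      by (simp add: revec_def vec_eq_iff)
    ultimately show "z \<in> T" unfolding \<omega>(2) by blast
  qed
  show "connected {x. cvec x \<in> T}" using \<omega>(1) by (simp add: T)
  show "z \<in> T \<Longrightarrow> revec z' = revec z \<Longrightarrow> z' \<in> T" by (simp add: T)
qed

lemma imaginary_shift: "z + (\<chi> i. \<i> * complex_of_real (((\<chi> j. Im (z' $ j) - Im (z $ j)) :: real ^ 'n) $ i)) = z'"
  if "revec z' = revec z" for z z' :: "complex ^ 'n"
  using that by (simp add: vec_eq_iff revec_def complex_eq_iff)

text \<open>Along the complex line through two points of the fibre in the direction of their real
difference, \<open>\<phi>\<close> is a subharmonic function of the real part alone.\<close>

lemma sublevel_fiber_convex:
  fixes \<phi> :: "(complex ^ 'r) \<times> (complex ^ 'n) \<Rightarrow> ereal"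
  assumes psh: "plurisubharmonic_on \<phi> \<Omega>" and tube: "tube_fibers \<Omega>"
    and conv: "convex {x. (t, cvec x) \<in> \<Omega>}"
    and inv: "\<And>z z'. (t, z) \<in> \<Omega> \<Longrightarrow> revec z' = revec z \<Longrightarrow> \<phi> (t, z') = \<phi> (t, z)"
  shows "convex {x. (t, cvec x) \<in> \<Omega> \<and> \<phi> (t, cvec x) < ereal c}"
proof -
  have "(t, cvec ((1 - v) *\<^sub>R x + v *\<^sub>R y)) \<in> \<Omega> \<and> \<phi> (t, cvec ((1 - v) *\<^sub>R x + v *\<^sub>R y)) < ereal c"
    if x: "(t, cvec x) \<in> \<Omega>" "\<phi> (t, cvec x) < ereal c" and y: "(t, cvec y) \<in> \<Omega>" "\<phi> (t, cvec y) < ereal c"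
      and v: "0 \<le> v" "v \<le> 1" for x y v
  proof -
    define S where "S = {\<zeta>. (t, cvec x) + \<zeta> *\<^sub>C (0, cvec (y - x)) \<in> \<Omega>}"
    define u where "u \<zeta> = \<phi> ((t, cvec x) + \<zeta> *\<^sub>C (0, cvec (y - x)))" for \<zeta>
    have z0: "c *\<^sub>C 0 = (0 :: complex ^ 'r)" for c by (simp add: vec_eq_iff scaleC_vec_component)
    have line: "(t, cvec x) + \<zeta> *\<^sub>C (0, cvec (y - x)) = (t, cvec x + \<zeta> *\<^sub>C cvec (y - x))" for \<zeta>
      by (simp add: scaleC_prod_def z0)
    have real: "cvec x + of_real s *\<^sub>C cvec (y - x) = cvec ((1 - s) *\<^sub>R x + s *\<^sub>R y)" for s
      by (simp add: vec_eq_iff scaleC_vec_component cvec_def algebra_simps)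
    have re: "revec (cvec x + \<zeta> *\<^sub>C cvec (y - x)) = (1 - Re \<zeta>) *\<^sub>R x + Re \<zeta> *\<^sub>R y" for \<zeta>
      by (simp add: vec_eq_iff scaleC_vec_component cvec_def revec_def algebra_simps)
    have seg: "(t, cvec ((1 - s) *\<^sub>R x + s *\<^sub>R y)) \<in> \<Omega>" if "0 \<le> s" "s \<le> 1" for s
      using conv x(1) y(1) that unfolding convex_alt by auto
    have "u (of_real v) < ereal c"
    proof (rule Re_invariant_subharmonic_quasiconvex[of u S])
      show "subharmonic_on u S"
        using psh x(1) unfolding plurisubharmonic_on_def u_def S_def by blast
      show "of_real s \<in> S" if "0 \<le> s" "s \<le> 1" for s
        using seg[OF that] by (simp add: S_def line real)
      show "u z = u (of_real (Re z))" if "z \<in> S" for z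
        using that inv[of "cvec x + z *\<^sub>C cvec (y - x)" "cvec x + of_real (Re z) *\<^sub>C cvec (y - x)"]
        by (simp add: S_def u_def line re)
      show "u 0 < ereal c" using x(2) real[of 0] by (simp add: u_def line)
      show "u 1 < ereal c" using y(2) real[of 1] by (simp add: u_def line)
    qed fact+
    then show ?thesis using seg[OF v] by (simp add: u_def line real)
  qed
  then show ?thesis unfolding convex_alt by auto
qed

text \<open>A selection principle in the style of Michael: the sets have locally constant local selections,
and convexity allows to glue them by a partition of unity.\<close>

lemma continuous_selection_convex:
  fixes A :: "'a::metric_space \<Rightarrow> 'b::real_normed_vector set"
  assumes "compact K" and conv: "\<And>z. z \<in> K \<Longrightarrow> convex (A z)"
    and loc: "\<And>z. z \<in> K \<Longrightarrow> \<exists>U x. open U \<and> z \<in> U \<and> (\<forall>y\<in>U \<inter> K. x \<in> A y)"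
  obtains f where "continuous_on K f" "\<And>z. z \<in> K \<Longrightarrow> f z \<in> A z"
proof -
  define \<C>0 where "\<C>0 = {U. open U \<and> (\<exists>x. \<forall>y\<in>U \<inter> K. x \<in> A y)}"
  have "K \<subseteq> \<Union>\<C>0" "\<And>U. U \<in> \<C>0 \<Longrightarrow> open U" using loc unfolding \<C>0_def by blast+
  then obtain \<C> where \<C>: "\<C> \<subseteq> \<C>0" "finite \<C>" "K \<subseteq> \<Union>\<C>"
    using compactE[OF \<open>compact K\<close>] by metis
  have op: "\<And>U. U \<in> \<C> \<Longrightarrow> open U" using \<C>(1) by (auto simp: \<C>0_def)
  have fin: "\<exists>V. open V \<and> x \<in> V \<and> finite {U \<in> \<C>. U \<inter> V \<noteq> {}}" for x
    using \<C>(2) by (intro exI[of _ UNIV]) auto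
  obtain F :: "['a set, 'a] \<Rightarrow> real" where
    F1: "\<And>U. U \<in> \<C> \<Longrightarrow> continuous_on K (F U) \<and> (\<forall>x \<in> K. 0 \<le> F U x)"
    and F2: "\<And>x U. \<lbrakk>U \<in> \<C>; x \<in> K; x \<notin> U\<rbrakk> \<Longrightarrow> F U x = 0"
    and F3: "\<And>x. x \<in> K \<Longrightarrow> supp_sum (\<lambda>W. F W x) \<C> = 1"
    by (rule subordinate_partition_of_unity[OF \<C>(3) op fin]) blast+
  have F3': "(\<Sum>W\<in>\<C>. F W x) = 1" if "x \<in> K" for x
  proof -
    have "supp_sum (\<lambda>W. F W x) \<C> = (\<Sum>W\<in>\<C>. F W x)"
      unfolding supp_sum_def support_on_def by (rule sum.mono_neutral_left) (use \<C>(2) in auto)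
    then show ?thesis using F3[OF that] by simp
  qed
  have "\<exists>x. \<forall>y\<in>U \<inter> K. x \<in> A y" if "U \<in> \<C>" for U using that \<C>(1) by (auto simp: \<C>0_def)
  then obtain p where p: "\<And>U y. U \<in> \<C> \<Longrightarrow> y \<in> U \<Longrightarrow> y \<in> K \<Longrightarrow> p U \<in> A y" by (metis IntI)
  define f where "f z = (\<Sum>U\<in>\<C>. F U z *\<^sub>R p U)" for z
  show ?thesis
  proof (rule that[of f])
    show "continuous_on K f" unfolding f_def using F1 by (intro continuous_intros) auto
    fix z assume z: "z \<in> K"
    let ?D = "{U \<in> \<C>. z \<in> U}"
    have 1: "(\<Sum>U\<in>?D. F U z) = 1"
      unfolding F3'[OF z, symmetric] by (rule sum.mono_neutral_left) (use \<C>(2) F2 z in auto)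
    have "f z = (\<Sum>U\<in>?D. F U z *\<^sub>R p U)"
      unfolding f_def by (rule sum.mono_neutral_right) (use \<C>(2) F2 z in auto)
    also have "\<dots> \<in> A z"
      by (rule convex_sum[OF _ conv[OF z] 1]) (use \<C>(2) F1 p z in auto)
    finally show "f z \<in> A z" .
  qed
qed

text \<open>The two open conditions, one over \<open>K\<close> and a stronger one over the subset \<open>L\<close>, are those of lying
in the domain over the closed disc and of satisfying the bound over the circle.\<close>

lemma graph_polynomial_approximation:
  fixes f :: "'a::euclidean_space \<Rightarrow> 'b::euclidean_space"
  assumes K: "compact K" and f: "continuous_on K f" and W: "open W" and fW: "\<And>z. z \<in> K \<Longrightarrow> (z, f z) \<in> W"
    and L: "compact L" "L \<subseteq> K" and V: "open V" and fV: "\<And>z. z \<in> L \<Longrightarrow> (z, f z) \<in> V"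
  obtains q where "polynomial_function q" "\<And>z. z \<in> K \<Longrightarrow> (z, q z) \<in> W" "\<And>z. z \<in> L \<Longrightarrow> (z, q z) \<in> V"
proof -
  have cpt: "compact ((\<lambda>z. (z, f z)) ` K)" "compact ((\<lambda>z. (z, f z)) ` L)"
    by (intro compact_continuous_image continuous_intros K L f continuous_on_subset[OF f])+
  have sub: "(\<lambda>z. (z, f z)) ` K \<subseteq> W" "(\<lambda>z. (z, f z)) ` L \<subseteq> V" using fW fV by auto
  obtain e1 where e1: "e1 > 0" "(\<Union>x\<in>(\<lambda>z. (z, f z)) ` K. cball x e1) \<subseteq> W"
    by (rule compact_subset_open_imp_cball_epsilon_subset[OF cpt(1) W sub(1)])
  obtain e2 where e2: "e2 > 0" "(\<Union>x\<in>(\<lambda>z. (z, f z)) ` L. cball x e2) \<subseteq> V"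
    by (rule compact_subset_open_imp_cball_epsilon_subset[OF cpt(2) V sub(2)])
  define e where "e = min e1 e2"
  have "e > 0" using e1 e2 by (simp add: e_def)
  from Stone_Weierstrass_polynomial_function[OF K f this]
  obtain q where q: "polynomial_function q" "\<And>z. z \<in> K \<Longrightarrow> norm (f z - q z) < e" by blast
  have "(z, q z) \<in> cball (z, f z) e" if "z \<in> K" for z
    using q(2)[OF that] by (simp add: dist_Pair_Pair dist_norm)
  then have "(z, q z) \<in> cball (z, f z) e1" "(z, q z) \<in> cball (z, f z) e2" if "z \<in> K" for z
    using that by (auto simp: e_def)
  then show ?thesis using that[OF q(1)] e1(2) e2(2) L(2) by blast
qed

section \<open>The minimum principle\<close>

text \<open>The core of the proof.  Over the unit circle choose points of the fibres where \<open>\<phi> < Re p\<close>,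
over the open disc arbitrary points of the fibres.  These conditions define convex sets, so
there is a continuous choice over the closed disc, and even a polynomial one, \<open>q\<close>.  Replacing \<open>q\<close> by
the harmonic extension of its values on the circle gives the real part of an analytic disc.  The disc
lies in \<open>\<Omega>\<close> by the continuity principle, and its boundary still satisfies \<open>\<phi> < Re p\<close> as \<open>\<phi>\<close>
is independent of imaginary parts.  The maximum principle carries the bound to the centre.\<close>

lemma fiberwise_infimum_harmonic_bound:
  fixes \<Omega> :: "((complex ^ 'r) \<times> (complex ^ 'n)) set" and \<phi> :: "(complex ^ 'r) \<times> (complex ^ 'n) \<Rightarrow> ereal"
  assumes pc: "pseudoconvex_domain \<Omega>" and psh: "plurisubharmonic_on \<phi> \<Omega>" and tube: "tube_fibers \<Omega>"
    and conn: "\<And>t. connected {x. (t, cvec x) \<in> \<Omega>}"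
    and inv: "\<And>t z z'. (t, z) \<in> \<Omega> \<Longrightarrow> revec z' = revec z \<Longrightarrow> \<phi> (t, z') = \<phi> (t, z)"
    and disc: "\<And>\<zeta>. norm \<zeta> \<le> 1 \<Longrightarrow> \<exists>z. (a + \<zeta> *\<^sub>C w, z) \<in> \<Omega>"
    and holp: "p holomorphic_on UNIV"
    and circ: "\<And>\<zeta>. norm \<zeta> = 1 \<Longrightarrow> \<exists>z. (a + \<zeta> *\<^sub>C w, z) \<in> \<Omega> \<and> \<phi> (a + \<zeta> *\<^sub>C w, z) < ereal (Re (p \<zeta>))"
  shows "\<exists>z. (a, z) \<in> \<Omega> \<and> \<phi> (a, z) \<le> ereal (Re (p 0))"
proof -
  have open\<Omega>: "open \<Omega>" using pc by (simp add: pseudoconvex_domain_def)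
  have usc: "usc_on \<phi> \<Omega>" using psh by (simp add: plurisubharmonic_on_def)
  have contp: "continuous_on S p" for S
    by (intro holomorphic_on_imp_continuous_on holomorphic_on_subset[OF holp]) auto
  define G where "G y = (a + fst y *\<^sub>C w, cvec (snd y))" for y :: "complex \<times> (real ^ 'n)"
  have contG: "continuous_on S G" for S unfolding G_def by (intro continuous_intros)
  define W where "W = G -` \<Omega>"
  have openW: "open W" unfolding W_def using open\<Omega> contG by (intro open_vimage) auto
  define g where "g y = \<phi> (G y) + ereal (- Re (p (fst y)))" for y
  have "usc_on g W"
    unfolding g_def
  proof (rule usc_on_add_continuous)
    show "usc_on (\<lambda>y. \<phi> (G y)) W" by (rule usc_on_compose[OF usc contG]) (auto simp: W_def)
    show "continuous_on W (\<lambda>y. - Re (p (fst y)))"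
      by (intro continuous_intros continuous_on_compose2[OF contp]) auto
  qed
  then obtain U where U: "open U" "{y\<in>W. g y < 0} = W \<inter> U" unfolding usc_on_iff_open by blast
  have g0: "g y < 0 \<longleftrightarrow> \<phi> (G y) < ereal (Re (p (fst y)))" for y
    by (cases "\<phi> (G y)") (auto simp: g_def)
  \<comment> \<open>An open set of pairs in which the strict bound holds; openness is where upper semicontinuity of \<open>\<phi>\<close> enters.\<close>
  define V where "V = W \<inter> U"
  have V: "open V" "(\<zeta>, x) \<in> V \<longleftrightarrow> (\<zeta>, x) \<in> W \<and> \<phi> (a + \<zeta> *\<^sub>C w, cvec x) < ereal (Re (p \<zeta>))" for \<zeta> x
  proof -
    show "open V" using openW U(1) by (simp add: V_def open_Int)
    show "(\<zeta>, x) \<in> V \<longleftrightarrow> (\<zeta>, x) \<in> W \<and> \<phi> (a + \<zeta> *\<^sub>C w, cvec x) < ereal (Re (p \<zeta>))"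
      using g0[of "(\<zeta>, x)"] unfolding V_def U(2)[symmetric] by (simp add: G_def)
  qed
  have inW: "(\<zeta>, x) \<in> W \<longleftrightarrow> (a + \<zeta> *\<^sub>C w, cvec x) \<in> \<Omega>" for \<zeta> x by (simp add: W_def G_def)
  define A where "A \<zeta> = {x. (\<zeta>, x) \<in> W \<and> (norm \<zeta> = 1 \<longrightarrow> (\<zeta>, x) \<in> V)}" for \<zeta>
  have conv: "convex {x. (t, cvec x) \<in> \<Omega>}" for t by (rule tube_fiber_convex[OF pc tube conn])
  obtain f where f: "continuous_on (cball 0 1) f" "\<And>\<zeta>. \<zeta> \<in> cball 0 1 \<Longrightarrow> f \<zeta> \<in> A \<zeta>"
  proof (rule continuous_selection_convex[of "cball (0::complex) 1" A])
    fix \<zeta> :: complex assume \<zeta>: "\<zeta> \<in> cball 0 1"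
    show "convex (A \<zeta>)"
    proof (cases "norm \<zeta> = 1")
      case True
      then have "A \<zeta> = {x. (a + \<zeta> *\<^sub>C w, cvec x) \<in> \<Omega> \<and> \<phi> (a + \<zeta> *\<^sub>C w, cvec x) < ereal (Re (p \<zeta>))}"
        by (auto simp: A_def V inW)
      then show ?thesis using sublevel_fiber_convex[OF psh tube conv inv] by simp
    next
      case False
      then show ?thesis using conv by (simp add: A_def inW)
    qed
    show "\<exists>U x. open U \<and> \<zeta> \<in> U \<and> (\<forall>y\<in>U \<inter> cball 0 1. x \<in> A y)"
    proof (cases "norm \<zeta> = 1")
      case True
      then obtain z where z: "(a + \<zeta> *\<^sub>C w, z) \<in> \<Omega>" "\<phi> (a + \<zeta> *\<^sub>C w, z) < ereal (Re (p \<zeta>))" using circ by blast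
      have "(\<zeta>, revec z) \<in> V"
        using z inv[OF z(1), of "cvec (revec z)"] tube_fibers_iff[OF tube, of "a + \<zeta> *\<^sub>C w" z] by (simp add: V inW)
      then have "open ((\<lambda>y. (y, revec z)) -` V)" "\<zeta> \<in> (\<lambda>y. (y, revec z)) -` V"
        by (auto intro!: open_vimage V continuous_intros)
      moreover have "\<forall>y\<in>(\<lambda>y. (y, revec z)) -` V \<inter> cball 0 1. revec z \<in> A y" by (auto simp: A_def V)
      ultimately show ?thesis by blast
    next
      case False
      obtain z where z: "(a + \<zeta> *\<^sub>C w, z) \<in> \<Omega>" using disc \<zeta> by auto
      then have "(\<zeta>, revec z) \<in> W"
        using tube_fibers_iff[OF tube, of "a + \<zeta> *\<^sub>C w" z] by (simp add: inW)
      then have "open ((\<lambda>y. (y, revec z)) -` W \<inter> - sphere 0 1)" "\<zeta> \<in> (\<lambda>y. (y, revec z)) -` W \<inter> - sphere 0 1"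
        using False by (auto intro!: open_vimage openW continuous_intros open_Int)
      moreover have "\<forall>y\<in>((\<lambda>y. (y, revec z)) -` W \<inter> - sphere 0 1) \<inter> cball 0 1. revec z \<in> A y" by (auto simp: A_def)
      ultimately show ?thesis by blast
    qed
  qed auto
  obtain q where q: "polynomial_function q" "\<And>\<zeta>. \<zeta> \<in> cball 0 1 \<Longrightarrow> (\<zeta>, q \<zeta>) \<in> W" "\<And>\<zeta>. \<zeta> \<in> sphere 0 1 \<Longrightarrow> (\<zeta>, q \<zeta>) \<in> V"
    by (rule graph_polynomial_approximation[of "cball (0::complex) 1" f W "sphere 0 1" V])
      (use f openW V(1) in \<open>auto simp: A_def\<close>)
  obtain P :: "real \<Rightarrow> complex \<Rightarrow> complex ^ 'n"
    where P: "continuous_on UNIV (\<lambda>x. P (fst x) (snd x))" "\<And>s i. (\<lambda>z. P s z $ i) holomorphic_on UNIV"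
      "\<And>s z. norm z = 1 \<Longrightarrow> revec (P s z) = q (of_real s * z)" "\<And>z. revec (P 0 z) = q 0"
    using polynomial_harmonic_extension[OF q(1)] by blast
  have in\<Omega>: "(a + \<zeta> *\<^sub>C w, P 1 \<zeta>) \<in> \<Omega>" if "norm \<zeta> \<le> 1" for \<zeta>
    using analytic_discs_stay_in_domain[OF pc tube P, of a w 1 \<zeta>] q(2) that by (simp add: inW)
  have "\<phi> (a + 0 *\<^sub>C w, P 1 0) \<le> ereal (Re (p 0))"
  proof (rule psh_disc_max_principle[OF psh P(2) holp])
    show "(a + \<zeta> *\<^sub>C w, P 1 \<zeta>) \<in> \<Omega>" if "norm \<zeta> \<le> 1" for \<zeta> using in\<Omega>[OF that] .
    show "\<phi> (a + \<zeta> *\<^sub>C w, P 1 \<zeta>) \<le> ereal (Re (p \<zeta>))" if "norm \<zeta> = 1" for \<zeta>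
    proof -
      have "(\<zeta>, q \<zeta>) \<in> V" using q(3) that by simp
      then show ?thesis
        using inv[of "a + \<zeta> *\<^sub>C w" "cvec (q \<zeta>)" "P 1 \<zeta>"] P(3)[OF that, of 1] by (auto simp: V inW)
    qed
  qed auto
  moreover have "a + 0 *\<^sub>C w = a" by (simp add: vec_eq_iff scaleC_vec_component)
  ultimately show ?thesis using in\<Omega>[of 0] by auto
qed

theorem theorem1p1:
  fixes \<Omega> :: "((complex ^ 'r) \<times> (complex ^ 'n)) set"
    and \<phi> :: "(complex ^ 'r) \<times> (complex ^ 'n) \<Rightarrow> ereal"
  assumes "pseudoconvex_domain \<Omega>"
    and "plurisubharmonic_on \<phi> \<Omega>"
    and "\<And>t. t \<in> fst ` \<Omega> \<Longrightarrow> connected_tube_domain (fiber \<Omega> t)"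
    and "\<And>t z (y :: real ^ 'n). (t, z) \<in> \<Omega> \<Longrightarrow>
           \<phi> (t, z + (\<chi> i. \<i> * complex_of_real (y $ i))) = \<phi> (t, z)"
  shows "plurisubharmonic_on (\<lambda>t. INF z\<in>fiber \<Omega> t. \<phi> (t, z)) (fst ` \<Omega>)"
proof -
  define \<psi> where "\<psi> t = (INF z\<in>fiber \<Omega> t. \<phi> (t, z))" for t
  define U where "U = fst ` \<Omega>"
  have open\<Omega>: "open \<Omega>" using assms(1) by (simp add: pseudoconvex_domain_def)
  have usc\<phi>: "usc_on \<phi> \<Omega>" and fin: "\<And>x. x \<in> \<Omega> \<Longrightarrow> \<phi> x < \<infinity>"
    using assms(2) by (auto simp: plurisubharmonic_on_def)
  have openU: "open U" unfolding U_def by (rule open_image_fst[OF open\<Omega>])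
  have U: "t \<in> U \<longleftrightarrow> (\<exists>z. (t, z) \<in> \<Omega>)" for t by (force simp: U_def)
  have \<psi>_less: "\<psi> t < c \<longleftrightarrow> (\<exists>z. (t, z) \<in> \<Omega> \<and> \<phi> (t, z) < c)" for t c
    by (auto simp: \<psi>_def INF_less_iff fiber_def)
  have \<psi>_fin: "\<psi> t < \<infinity>" if "t \<in> U" for t using that fin unfolding \<psi>_less U by blast
  have tube: "tube_fibers \<Omega>"
    unfolding tube_fibers_def
    using connected_tube_domainD(2)[OF assms(3)] by (force simp: fiber_def)
  have conn: "connected {x. (t, cvec x) \<in> \<Omega>}" for t
  proof (cases "t \<in> U")
    case True
    then show ?thesis using connected_tube_domainD(1)[OF assms(3)[of t]] by (simp add: U_def fiber_def)
  qed (simp add: U)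
  have inv: "\<phi> (t, z') = \<phi> (t, z)" if "(t, z) \<in> \<Omega>" "revec z' = revec z" for t z z'
    using assms(4)[OF that(1), of "\<chi> j. Im (z' $ j) - Im (z $ j)"] imaginary_shift[OF that(2)] by simp
  have usc: "usc_on \<psi> U"
    unfolding usc_on_iff_open
  proof
    fix c
    obtain T where T: "open T" "{x\<in>\<Omega>. \<phi> x < c} = \<Omega> \<inter> T" using usc\<phi> unfolding usc_on_iff_open by blast
    have "{t \<in> U. \<psi> t < c} = fst ` (\<Omega> \<inter> T)"
      unfolding T(2)[symmetric] \<psi>_less U by force
    moreover have "fst ` (\<Omega> \<inter> T) \<subseteq> U" by (auto simp: U_def)
    ultimately show "\<exists>V. open V \<and> {t \<in> U. \<psi> t < c} = U \<inter> V"
      using open_image_fst[OF open_Int[OF open\<Omega> T(1)]] by blast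
  qed
  have sub: "subharmonic_on (\<lambda>\<zeta>. \<psi> (a + \<zeta> *\<^sub>C w)) {\<zeta>. a + \<zeta> *\<^sub>C w \<in> U}" for a w
    unfolding subharmonic_on_def
  proof (intro conjI ballI allI impI)
    have cont: "continuous_on S (\<lambda>\<zeta>. a + \<zeta> *\<^sub>C w)" for S :: "complex set" by (intro continuous_intros)
    show "open {\<zeta>. a + \<zeta> *\<^sub>C w \<in> U}" using open_vimage[OF openU cont] by (simp add: vimage_def)
    show "usc_on (\<lambda>\<zeta>. \<psi> (a + \<zeta> *\<^sub>C w)) {\<zeta>. a + \<zeta> *\<^sub>C w \<in> U}"
      by (rule usc_on_compose[OF usc cont]) auto
    fix b r assume br: "0 < r \<and> cball b r \<subseteq> {\<zeta>. a + \<zeta> *\<^sub>C w \<in> U}"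
    \<comment> \<open>An affine change of parameter turns the given circle into the unit circle.\<close>
    define a' w' where "a' = a + b *\<^sub>C w" and "w' = of_real r *\<^sub>C w"
    have line: "a + (b + of_real r * \<zeta>) *\<^sub>C w = a' + \<zeta> *\<^sub>C w'" for \<zeta>
      by (simp add: a'_def w'_def scaleC_add_left scaleC_scaleC mult.commute add.assoc)
    have inU: "a' + \<zeta> *\<^sub>C w' \<in> U" if "norm \<zeta> \<le> 1" for \<zeta>
    proof -
      have "b + of_real r * \<zeta> \<in> cball b r" using br that by (simp add: dist_norm norm_mult)
      then show ?thesis using br line by auto
    qed
    define v where "v \<zeta> = \<psi> (a' + \<zeta> *\<^sub>C w')" for \<zeta>
    have mean: "circle_mean (\<lambda>\<zeta>. \<psi> (a + \<zeta> *\<^sub>C w)) b r = circle_mean v 0 1"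
      by (simp add: circle_mean_def v_def line)
    have "\<psi> a' \<le> circle_mean v 0 1"
    proof (rule ccontr)
      assume "\<not> ?thesis"
      then obtain c where c: "circle_mean v 0 1 < ereal c" "ereal c < \<psi> a'"
        using ereal_dense2[of "circle_mean v 0 1" "\<psi> a'"] by (auto simp: not_le)
      have "usc_on v (sphere 0 1)"
        unfolding v_def by (rule usc_on_compose[OF usc]) (use inU in \<open>auto intro!: continuous_intros\<close>)
      moreover have "v z < \<infinity>" if "norm z = 1" for z using \<psi>_fin inU that by (simp add: v_def)
      ultimately obtain p where p: "p holomorphic_on UNIV" "\<And>z. norm z = 1 \<Longrightarrow> v z < ereal (Re (p z))" "Re (p 0) < c"
        using circle_mean_harmonic_majorant c(1) by blast
      have "\<exists>z. (a', z) \<in> \<Omega> \<and> \<phi> (a', z) \<le> ereal (Re (p 0))"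
      proof (rule fiberwise_infimum_harmonic_bound[OF assms(1,2) tube conn inv _ p(1)])
        show "\<exists>z. (a' + \<zeta> *\<^sub>C w', z) \<in> \<Omega>" if "norm \<zeta> \<le> 1" for \<zeta> using inU[OF that] by (simp add: U)
        show "\<exists>z. (a' + \<zeta> *\<^sub>C w', z) \<in> \<Omega> \<and> \<phi> (a' + \<zeta> *\<^sub>C w', z) < ereal (Re (p \<zeta>))" if "norm \<zeta> = 1" for \<zeta>
          using p(2)[OF that] unfolding v_def \<psi>_less .
      qed
      then obtain z where z: "(a', z) \<in> \<Omega>" "\<phi> (a', z) \<le> ereal (Re (p 0))" by blast
      then have "\<phi> (a', z) < ereal c" using p(3) by (simp add: le_less_trans)
      then have "\<psi> a' < ereal c" using z(1) unfolding \<psi>_less by blast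
      then show False using c(2) by simp
    qed
    then show "\<psi> (a + b *\<^sub>C w) \<le> circle_mean (\<lambda>\<zeta>. \<psi> (a + \<zeta> *\<^sub>C w)) b r"
      by (simp add: mean a'_def)
  qed (use \<psi>_fin in auto)
  show ?thesis
    unfolding \<psi>_def[symmetric] U_def[symmetric] plurisubharmonic_on_def
    using openU \<psi>_fin usc sub by blast
qed

end
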